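(* Let $\delta\in\operatorname{GSp}(W)$ be an element of similitude $-1$. For all $\tilde g\in\operatorname{Mp}(W)$, the elements ${}^{\delta}\tilde g$ and $\tilde g^{-1}$ are conjugate in $\operatorname{Mp}(W)$.
   Context: $F$ is a non-archimedean local field of characteristic different from $2$ and residue characteristic $p$. $(W,\langle\,,\,\rangle)$ is a nondegenerate symplectic space over $F$ of dimension $2n$. $\operatorname{Mp}(W)$ is the metaplectic group, i.e. the unique non-trivial (topological) central extension $1\to\mu_2\to\operatorname{Mp}(W)\to\operatorname{Sp}(W)\to 1$, where $\mu_2=\{\pm1\}$. An element $\delta\in\operatorname{GSp}(W)$ has similitude $-1$ if $\langle \delta w,\delta w'\rangle=-\langle w,w'\rangle$ for all $w,w'\in W$. It is known that the automorphism $g\mapsto \delta g\delta^{-1}$ of $\operatorname{Sp}(W)$ lifts uniquely to an automorphism of the group $\operatorname{Mp}(W)$, denoted $\tilde g\mapsto {}^{\delta}\tilde g$. *)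

theory Defs
  imports "HOL-Analysis.Analysis" "HOL-Algebra.Coset"
begin

section \<open>Non-archimedean local fields\<close>

locale nonarch_local_field =
  fixes absv :: "'a::field \<Rightarrow> real"
  assumes absv_nonneg: "0 \<le> absv x"
    and absv_eq_0_iff: "absv x = 0 \<longleftrightarrow> x = 0"
    and absv_mult: "absv (x * y) = absv x * absv y"
    and absv_ultrametric: "absv (x + y) \<le> max (absv x) (absv y)"
    and absv_nontrivial: "\<exists>x. x \<noteq> 0 \<and> absv x \<noteq> 1"
    and locally_compact:
      "locally_compact_space (Metric_space.mtopology UNIV (\<lambda>x y. absv (x - y)))"

definition field_topology :: "('a::field \<Rightarrow> real) \<Rightarrow> 'a topology" where
  "field_topology absv = Metric_space.mtopology UNIV (\<lambda>x y. absv (x - y))"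

text \<open>The characteristic of the residue field: the image of a natural number in the residue
  field vanishes iff its absolute value is less than 1.\<close>

definition residue_char :: "('a::field \<Rightarrow> real) \<Rightarrow> nat" where
  "residue_char absv = Gcd {m. absv (of_nat m) < 1}"


section \<open>Symplectic spaces and symplectic groups\<close>

text \<open>Since \<open>dim\<close> is 0 on spaces of infinite dimension, finite dimensionality is
  required separately.\<close>

locale symplectic_space = vector_space scl
  for scl :: "'a::field \<Rightarrow> 'w::ab_group_add \<Rightarrow> 'w" +
  fixes B :: "'w \<Rightarrow> 'w \<Rightarrow> 'a" and n :: nat
  assumes finite_dimensional: "\<exists>S. finite S \<and> span S = UNIV"
    and dim_eq: "dim UNIV = 2 * n"
    and linear_left: "Vector_Spaces.linear scl (*) (\<lambda>w. B w w')"
    and linear_right: "Vector_Spaces.linear scl (*) (B w)"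
    and alternating: "B w w = 0"
    and nondegenerate: "(\<forall>w'. B w w' = 0) \<Longrightarrow> w = 0"

definition has_similitude :: "('w \<Rightarrow> 'w \<Rightarrow> 'a::field) \<Rightarrow> ('w \<Rightarrow> 'w) \<Rightarrow> 'a \<Rightarrow> bool" where
  "has_similitude B g c \<longleftrightarrow> (\<forall>w w'. B (g w) (g w') = c * B w w')"

definition GSp ::
  "('a::field \<Rightarrow> 'w::ab_group_add \<Rightarrow> 'w) \<Rightarrow> ('w \<Rightarrow> 'w \<Rightarrow> 'a) \<Rightarrow> ('w \<Rightarrow> 'w) monoid" where
  "GSp scl B =
    \<lparr>carrier = {g. Vector_Spaces.linear scl scl g \<and> bij g \<and>
                   (\<exists>c. c \<noteq> 0 \<and> has_similitude B g c)},
     mult = (\<circ>), one = id\<rparr>"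

definition Sp ::
  "('a::field \<Rightarrow> 'w::ab_group_add \<Rightarrow> 'w) \<Rightarrow> ('w \<Rightarrow> 'w \<Rightarrow> 'a) \<Rightarrow> ('w \<Rightarrow> 'w) monoid" where
  "Sp scl B = GSp scl B \<lparr>carrier := {g \<in> carrier (GSp scl B). has_similitude B g 1}\<rparr>"

lemma (in symplectic_space) group_GSp: "group (GSp scl B)"
proof (rule groupI)
  fix g h assume g: "g \<in> carrier (GSp scl B)" and h: "h \<in> carrier (GSp scl B)"
  obtain c d where c: "c \<noteq> 0" "has_similitude B g c" and d: "d \<noteq> 0" "has_similitude B h d"
    using g h by (auto simp: GSp_def)
  have "c * d \<noteq> 0 \<and> has_similitude B (g \<circ> h) (c * d)"
    using c d by (auto simp: has_similitude_def)
  then have "\<exists>c. c \<noteq> 0 \<and> has_similitude B (g \<circ> h) c"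
    by blast
  then show "g \<otimes>\<^bsub>GSp scl B\<^esub> h \<in> carrier (GSp scl B)"
    using g h Vector_Spaces.linear_compose[of scl scl h scl g] bij_comp[of h g]
    by (simp add: GSp_def)
next
  show "\<one>\<^bsub>GSp scl B\<^esub> \<in> carrier (GSp scl B)"
    using linear_id by (simp add: GSp_def has_similitude_def exI[of _ 1])
next
  fix g assume g: "g \<in> carrier (GSp scl B)"
  then have lin: "Vector_Spaces.linear scl scl g" and bij: "bij g"
    by (auto simp: GSp_def)
  obtain c where c: "c \<noteq> 0" "has_similitude B g c"
    using g by (auto simp: GSp_def)
  interpret g: Vector_Spaces.linear scl scl g by (fact lin)
  define k where "k = inv_into UNIV g"
  have gk: "g (k w) = w" and kg: "k (g w) = w" for w
    using bij by (simp_all add: k_def bij_is_surj bij_is_inj surj_f_inv_f)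
  have "Vector_Spaces.linear scl scl k"
  proof (unfold_locales)
    fix x y r
    have "k (x + y) = k (g (k x + k y))"
      by (simp add: g.add gk)
    then show "k (x + y) = k x + k y"
      by (simp add: kg)
    have "k (scl r x) = k (g (scl r (k x)))"
      by (simp add: g.scale gk)
    then show "k (scl r x) = scl r (k x)"
      by (simp add: kg)
  qed
  moreover have "has_similitude B k (inverse c)"
    unfolding has_similitude_def
  proof (intro allI)
    fix w w'
    have "B w w' = c * B (k w) (k w')"
      using c(2) gk[of w] gk[of w'] unfolding has_similitude_def by metis
    then show "B (k w) (k w') = inverse c * B w w'"
      using c(1) by simp
  qed
  moreover have "bij k"
    using bij by (simp add: k_def bij_imp_bij_inv)
  ultimately have "k \<in> carrier (GSp scl B)"
    using c(1) by (simp add: GSp_def exI[of _ "inverse c"])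
  moreover have "k \<circ> g = id"
    using kg by (simp add: fun_eq_iff)
  ultimately show "\<exists>h\<in>carrier (GSp scl B). h \<otimes>\<^bsub>GSp scl B\<^esub> g = \<one>\<^bsub>GSp scl B\<^esub>"
    by (intro bexI[of _ k]) (simp_all add: GSp_def)
qed (auto simp: GSp_def)

lemma (in symplectic_space) subgroup_Sp: "subgroup (carrier (Sp scl B)) (GSp scl B)"
proof -
  interpret G: group "GSp scl B" by (fact group_GSp)
  show ?thesis
  proof (rule G.subgroupI)
    fix g assume g: "g \<in> carrier (Sp scl B)"
    then have gG: "g \<in> carrier (GSp scl B)" and s: "has_similitude B g 1"
      by (auto simp: Sp_def)
    have r: "g (m_inv (GSp scl B) g w) = w" for w
      using G.r_inv[OF gG] by (simp add: GSp_def fun_eq_iff)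
    have "has_similitude B (m_inv (GSp scl B) g) 1"
      using s r unfolding has_similitude_def by (metis mult_1)
    then show "m_inv (GSp scl B) g \<in> carrier (Sp scl B)"
      using gG by (simp add: Sp_def)
  next
    fix g h assume "g \<in> carrier (Sp scl B)" "h \<in> carrier (Sp scl B)"
    then show "g \<otimes>\<^bsub>GSp scl B\<^esub> h \<in> carrier (Sp scl B)"
      using G.m_closed by (auto simp: Sp_def) (auto simp: GSp_def has_similitude_def)
  next
    have "\<one>\<^bsub>GSp scl B\<^esub> \<in> carrier (Sp scl B)"
      using G.one_closed by (simp add: Sp_def) (simp add: GSp_def has_similitude_def)
    then show "carrier (Sp scl B) \<noteq> {}" by blast
  qed (auto simp: Sp_def)
qed

lemma (in symplectic_space) group_Sp: "group (Sp scl B)"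
  using group.subgroup_imp_group[OF group_GSp subgroup_Sp] by (simp add: Sp_def)

text \<open>By nondegeneracy every linear functional on \<open>W\<close> has the form \<open>\<lambda>w. B w w'\<close>, so this is the
  coarsest topology on \<open>Sp(W)\<close> for which all matrix coefficients are continuous, that is, the
  topology induced by the one of the finite-dimensional space \<open>End(W)\<close>.\<close>

definition Sp_topology ::
  "('a::field \<Rightarrow> real) \<Rightarrow> ('a \<Rightarrow> 'w::ab_group_add \<Rightarrow> 'w) \<Rightarrow> ('w \<Rightarrow> 'w \<Rightarrow> 'a) \<Rightarrow> ('w \<Rightarrow> 'w) topology"
  where
  "Sp_topology absv scl B =
    pullback_topology (carrier (Sp scl B)) (\<lambda>g (w, w'). B (g w) w')
      (product_topology (\<lambda>_. field_topology absv) UNIV)"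


section \<open>Topological central extensions and the metaplectic group\<close>

locale topological_group = group G for G (structure) +
  fixes T :: "'a topology"
  assumes topspace_eq: "topspace T = carrier G"
    and continuous_mult: "continuous_map (prod_topology T T) T (\<lambda>(x, y). x \<otimes> y)"
    and continuous_inv: "continuous_map T T (m_inv G)"

locale topological_central_extension =
  A: topological_group A TA + E: topological_group E TE + G: topological_group G TG
  for A :: "('a, 'r) monoid_scheme" and TA and E :: "('e, 's) monoid_scheme" and TE
    and G :: "('g, 't) monoid_scheme" and TG +
  fixes \<iota> :: "'a \<Rightarrow> 'e" and \<pi> :: "'e \<Rightarrow> 'g"
  assumes incl_hom: "\<iota> \<in> hom A E"
    and proj_hom: "\<pi> \<in> hom E G"
    and incl_embedding: "embedding_map TA TE \<iota>"
    and proj_quotient: "quotient_map TE TG \<pi>"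
    and exact: "\<iota> ` carrier A = kernel E G \<pi>"
    and central: "\<lbrakk>a \<in> carrier A; x \<in> carrier E\<rbrakk> \<Longrightarrow> \<iota> a \<otimes>\<^bsub>E\<^esub> x = x \<otimes>\<^bsub>E\<^esub> \<iota> a"

text \<open>A central extension is trivial (equivalent to the direct product) iff it has a section that
  is a continuous homomorphism.\<close>

definition continuously_split ::
  "('e, 's) monoid_scheme \<Rightarrow> 'e topology \<Rightarrow> ('g, 't) monoid_scheme \<Rightarrow> 'g topology \<Rightarrow>
   ('e \<Rightarrow> 'g) \<Rightarrow> bool" where
  "continuously_split E TE G TG \<pi> \<longleftrightarrow>
    (\<exists>\<sigma>. \<sigma> \<in> hom G E \<and> continuous_map TG TE \<sigma> \<and> (\<forall>g \<in> carrier G. \<pi> (\<sigma> g) = g))"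

definition mu2 :: "int monoid" where
  "mu2 = \<lparr>carrier = {1, -1}, mult = (*), one = 1\<rparr>"

text \<open>\<open>Mp(W)\<close> is determined up to isomorphism of extensions: it is any nontrivial topological
  central extension of \<open>Sp(W)\<close> by the discrete group of order 2.\<close>

definition metaplectic_extension ::
  "('a::field \<Rightarrow> real) \<Rightarrow> ('a \<Rightarrow> 'w::ab_group_add \<Rightarrow> 'w) \<Rightarrow> ('w \<Rightarrow> 'w \<Rightarrow> 'a) \<Rightarrow>
   ('m, 's) monoid_scheme \<Rightarrow> 'm topology \<Rightarrow> (int \<Rightarrow> 'm) \<Rightarrow> ('m \<Rightarrow> 'w \<Rightarrow> 'w) \<Rightarrow> bool" where
  "metaplectic_extension absv scl B Mp TMp \<iota> \<pi> \<longleftrightarrow>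
    topological_central_extension mu2 (discrete_topology (carrier mu2)) Mp TMp
      (Sp scl B) (Sp_topology absv scl B) \<iota> \<pi> \<and>
    \<not> continuously_split Mp TMp (Sp scl B) (Sp_topology absv scl B) \<pi>"

end

theory Submission
  imports Defs "HOL-Computational_Algebra.Polynomial"
begin

text \<open>Call a linear involution of \<open>W\<close> with similitude \<open>-1\<close> antisymplectic. The proof rests on two facts about
  them, which hold for every field of characteristic different from 2.

  First, every \<open>g\<close> in \<open>Sp(W)\<close> is a product of two antisymplectic involutions; equivalently, some antisymplectic
  involution \<open>s\<close> conjugates \<open>g\<close> to its inverse, and then \<open>g = s (s g)\<close>
  (\<open>inverted_by_antisymplectic_involution\<close>). The eigenspaces of \<open>s\<close> have to be isotropic subspaces
  that together span \<open>W\<close>; \<open>c = g + g\<^sup>-\<^sup>1\<close> has to preserve both and \<open>d = g - g\<^sup>-\<^sup>1\<close> to map each into the other.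
  Decomposing \<open>W\<close> orthogonally, one may assume that it has no nonzero proper nondegenerate subspace stable
  under \<open>c\<close> and \<open>d\<close>. Then \<open>W\<close> is a primary module over the algebra \<open>K\<close> of polynomials in \<open>c\<close>, and the eigenspaces are
  \<open>K v\<close> and \<open>K d v\<close> for a suitable vector \<open>v\<close>, or \<open>K v + K d w\<close> and \<open>K w + K d v\<close> for suitable \<open>v\<close> and \<open>w\<close>
  (\<open>ex_lagrangian_pair_block\<close>).

  Second, any two antisymplectic involutions are conjugate under \<open>Sp(W)\<close>
  (\<open>antisymplectic_involutions_conjugate\<close>).

  Now extend \<open>Mp(W)\<close> by lifts of the antisymplectic maps. The lift of an antisymplectic
  involution has a square in the central group of order two, and by conjugacy this square is the same
  for all of them. If \<open>x\<close> lifts \<open>g = s t\<close>, write \<open>x = a b\<close> with lifts \<open>a\<close> and \<open>b\<close> of \<open>s\<close> and \<open>t\<close>. Then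
  \<open>a x a\<^sup>-\<^sup>1 = a\<^sup>2 b a\<^sup>-\<^sup>1 = a\<^sup>2 b\<^sup>2 x\<^sup>-\<^sup>1 = x\<^sup>-\<^sup>1\<close>, because \<open>a\<^sup>2 = b\<^sup>2\<close> is central of order at most two. Since \<open>\<delta>\<close> differs
  from \<open>s\<close> by an element of \<open>Sp(W)\<close>, the image of \<open>x\<close> under the automorphism is conjugate to \<open>x\<^sup>-\<^sup>1\<close> in \<open>Mp(W)\<close>.
  The lemma \<open>lift_conjugate_to_inverse\<close> carries out this argument without constructing the larger group.\<close>

section \<open>Linear algebra of an alternating form\<close>

lemma eq_minus_self_imp_zero:
  fixes t :: "'a::field"
  assumes two: "(2::'a) \<noteq> 0" and "t = - t" shows "t = 0"
proof -
  have "t + t = 0" using assms(2) by (rule eq_neg_iff_add_eq_0[THEN iffD1])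
  then have "2 * t = 0" by (simp only: mult_2)
  then show ?thesis using two by simp
qed

context symplectic_space
begin

lemma B_add_left: "B (x + y) z = B x z + B y z"
  and B_scale_left: "B (scl a x) z = a * B x z"
  and B_diff_left: "B (x - y) z = B x z - B y z"
  and B_minus_left: "B (- x) z = - B x z"
  and B_zero_left: "B 0 z = 0"
proof -
  interpret l: Vector_Spaces.linear scl "(*)" "\<lambda>w. B w z" by (fact linear_left)
  show "B (x + y) z = B x z + B y z" "B (scl a x) z = a * B x z" "B (x - y) z = B x z - B y z"
    "B (- x) z = - B x z" "B 0 z = 0"
    by (rule l.add l.scale l.diff l.neg l.zero)+
qed

lemma B_add_right: "B z (x + y) = B z x + B z y"
  and B_scale_right: "B z (scl a x) = a * B z x"
  and B_diff_right: "B z (x - y) = B z x - B z y"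
  and B_minus_right: "B z (- x) = - B z x"
  and B_zero_right: "B z 0 = 0"
proof -
  interpret l: Vector_Spaces.linear scl "(*)" "B z" by (fact linear_right)
  show "B z (x + y) = B z x + B z y" "B z (scl a x) = a * B z x" "B z (x - y) = B z x - B z y"
    "B z (- x) = - B z x" "B z 0 = 0"
    by (rule l.add l.scale l.diff l.neg l.zero)+
qed

lemmas B_simps = B_add_left B_scale_left B_diff_left B_minus_left B_zero_left
  B_add_right B_scale_right B_diff_right B_minus_right B_zero_right

lemma B_skew: "B x y = - B y x"
proof -
  have "B (x + y) (x + y) = 0" by (rule alternating)
  then have "B x y + B y x = 0" unfolding B_add_left B_add_right by (simp add: alternating add.commute)
  then show ?thesis by (simp add: eq_neg_iff_add_eq_0)
qed

lemma B_zero_sym: "B x y = 0 \<Longrightarrow> B y x = 0"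
  using B_skew[of y x] by simp

lemma ex_finite_basis: "\<exists>Basis. finite_dimensional_vector_space scl Basis"
proof -
  obtain S where S: "finite S" "span S = UNIV" using finite_dimensional by blast
  obtain Bs where "Bs \<subseteq> S" "independent Bs" "S \<subseteq> span Bs"
    by (rule maximal_independent_subset)
  moreover from this S have "span Bs = UNIV"
    by (metis span_minimal subspace_span top.extremum_uniqueI)
  ultimately have "finite_dimensional_vector_space scl Bs"
    using S by unfold_locales (auto intro: finite_subset)
  then show ?thesis by blast
qed

lemma subspace_finitely_spanned:
  assumes "subspace U" shows "\<exists>S. finite S \<and> span S = U"
proof -
  obtain Bs where "finite_dimensional_vector_space scl Bs" using ex_finite_basis by blast
  then interpret f: finite_dimensional_vector_space scl Bs .
  obtain S where "S \<subseteq> U" "independent S" "U \<subseteq> span S"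
    by (rule basis_exists[of U])
  moreover from this have "finite S" by (intro f.finiteI_independent)
  moreover have "span S \<subseteq> U" by (rule span_minimal) fact+
  ultimately show ?thesis by blast
qed

lemma psubspace_dim_less:
  assumes "subspace R" "subspace U" "R \<subset> U" shows "dim R < dim U"
proof -
  obtain Bs where "finite_dimensional_vector_space scl Bs" using ex_finite_basis by blast
  then interpret f: finite_dimensional_vector_space scl Bs .
  show ?thesis using assms f.dim_psubset[of R U] span_eq_iff[THEN iffD2] by simp
qed

lemma linear_on_subspace_inj_imp_surj:
  assumes T: "Vector_Spaces.linear scl scl T" and R: "subspace R" "T ` R \<subseteq> R"
    and inj: "\<And>x. x \<in> R \<Longrightarrow> T x = 0 \<Longrightarrow> x = 0"
  shows "T ` R = R"
proof -
  obtain Bs where "finite_dimensional_vector_space scl Bs" using ex_finite_basis by blast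
  then interpret f: finite_dimensional_vector_space scl Bs .
  interpret t: Vector_Spaces.linear scl scl T by fact
  interpret p: finite_dimensional_vector_space_pair scl Bs scl Bs by unfold_locales
  have "inj_on T R"
  proof (rule inj_onI)
    fix x y assume "x \<in> R" "y \<in> R" "T x = T y"
    then have "x - y = 0" using inj[of "x - y"] R(1) by (simp add: subspace_diff t.diff)
    then show "x = y" by simp
  qed
  then have "dim (T ` R) = dim R"
    using p.dim_image_eq[OF T, of R] span_eq_iff[THEN iffD2, OF R(1)] by simp
  then show ?thesis
    using f.subspace_dim_equal[of "T ` R" R] R t.subspace_image by simp
qed

text \<open>Each member of \<open>S\<close> cuts \<open>U\<close> down by at most one dimension, so the coefficients of the combination are
  found one at a time. In the next two lemmas this takes the place of dual spaces and dimension counts.\<close>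

lemma functional_in_span:
  assumes "finite S" "subspace U"
    and "\<And>w. w \<in> U \<Longrightarrow> (\<And>s. s \<in> S \<Longrightarrow> B s w = 0) \<Longrightarrow> B x w = 0"
  shows "\<exists>y\<in>span S. \<forall>w\<in>U. B x w = B y w"
  using assms
proof (induction S arbitrary: U rule: finite_induct)
  case empty
  then show ?case by (auto simp: B_zero_left)
next
  case (insert s S)
  define U' where "U' = {w\<in>U. B s w = 0}"
  have "subspace U'"
    using insert.prems(1) unfolding U'_def subspace_def by (auto simp: B_simps)
  then obtain y where y: "y \<in> span S" "\<forall>w\<in>U'. B x w = B y w"
    using insert.IH[of U'] insert.prems(2) unfolding U'_def by auto
  have yS: "y \<in> span (insert s S)" using y(1) span_mono[of S "insert s S"] by blast
  show ?case
  proof (cases "U' = U")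
    case True
    then show ?thesis using y yS by blast
  next
    case False
    then obtain u where u: "u \<in> U" "B s u \<noteq> 0" by (auto simp: U'_def)
    define \<alpha> where "\<alpha> = B (x - y) u / B s u"
    have "B x w = B (y + scl \<alpha> s) w" if w: "w \<in> U" for w
    proof -
      let ?w = "w - scl (B s w / B s u) u"
      have "?w \<in> U'"
        using w u insert.prems(1) by (simp add: U'_def subspace_diff subspace_scale B_simps)
      then have "B (x - y) ?w = 0" using y(2) by (simp add: B_diff_left)
      then have "B x w - B y w = \<alpha> * B s w" by (simp add: B_simps \<alpha>_def)
      then show ?thesis by (simp add: B_simps algebra_simps)
    qed
    moreover have "y + scl \<alpha> s \<in> span (insert s S)"
      using yS by (simp add: span_add span_scale span_base)
    ultimately show ?thesis by blast
  qed
qed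

definition nondegenerate_on :: "'w set \<Rightarrow> bool" where
  "nondegenerate_on U \<longleftrightarrow> (\<forall>x\<in>U. (\<forall>y\<in>U. B x y = 0) \<longrightarrow> x = 0)"

definition isotropic :: "'w set \<Rightarrow> bool" where
  "isotropic L \<longleftrightarrow> (\<forall>x\<in>L. \<forall>y\<in>L. B x y = 0)"

text \<open>If no \<open>w\<close> separated \<open>x\<close> from \<open>Z\<close>, the functional of \<open>x\<close> would be represented on \<open>U\<close> by an element
  of \<open>Z\<close>, and nondegeneracy would identify that element with \<open>x\<close>.\<close>

lemma separate_from_subspace:
  assumes "nondegenerate_on U" "subspace U" "subspace Z" "Z \<subseteq> U" "x \<in> U" "x \<notin> Z"
  shows "\<exists>w\<in>U. (\<forall>z\<in>Z. B z w = 0) \<and> B x w \<noteq> 0"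
proof (rule ccontr)
  assume *: "\<not> ?thesis"
  obtain S where S: "finite S" "span S = Z" using subspace_finitely_spanned assms(3) by blast
  have "B x w = 0" if "w \<in> U" "\<And>s. s \<in> S \<Longrightarrow> B s w = 0" for w
  proof -
    have "subspace {z. B z w = 0}" by (auto simp: subspace_def B_simps)
    then have "Z \<subseteq> {z. B z w = 0}"
      using that(2) S(2) span_minimal[of S "{z. B z w = 0}"] by auto
    then show ?thesis using * that(1) by blast
  qed
  then obtain y where y: "y \<in> Z" "\<forall>w\<in>U. B x w = B y w"
    using functional_in_span[OF S(1) assms(2)] S(2) by blast
  have "x - y \<in> U" using assms y by (auto intro: subspace_diff)
  moreover have "\<forall>w\<in>U. B (x - y) w = 0" using y(2) by (simp add: B_simps)
  ultimately have "x - y = 0"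
    using assms(1) unfolding nondegenerate_on_def by blast
  then show False using y assms by simp
qed

text \<open>On a nondegenerate subspace every functional is represented by a vector, so there is an orthogonal
  projection onto it.\<close>

lemma orthogonal_projection:
  assumes "nondegenerate_on C" "subspace C"
  shows "\<exists>y\<in>C. \<forall>w\<in>C. B (x - y) w = 0"
proof -
  obtain S where S: "finite S" "span S = C" using subspace_finitely_spanned assms(2) by blast
  have "B x w = 0" if "w \<in> C" "\<And>s. s \<in> S \<Longrightarrow> B s w = 0" for w
  proof -
    have "subspace {z. B w z = 0}" by (auto simp: subspace_def B_simps)
    then have "C \<subseteq> {z. B w z = 0}"
      using that(2) B_zero_sym S(2) span_minimal[of S "{z. B w z = 0}"] by auto
    then have "w = 0" using assms(1) that(1) unfolding nondegenerate_on_def by blast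
    then show ?thesis by (simp add: B_simps)
  qed
  then obtain y where "y \<in> C" "\<forall>w\<in>C. B x w = B y w"
    using functional_in_span[OF S(1) assms(2)] S(2) by blast
  then show ?thesis by (auto simp: B_simps)
qed

definition sum_set :: "'w set \<Rightarrow> 'w set \<Rightarrow> 'w set" where
  "sum_set X Y = {x + y | x y. x \<in> X \<and> y \<in> Y}"

lemma subspace_sum_set: "subspace X \<Longrightarrow> subspace Y \<Longrightarrow> subspace (sum_set X Y)"
  unfolding sum_set_def by (rule subspace_sums)

lemma sum_set_memI: "x \<in> X \<Longrightarrow> y \<in> Y \<Longrightarrow> x + y \<in> sum_set X Y"
  by (auto simp: sum_set_def)

lemma sum_set_interchange:
  "sum_set (sum_set X Y) (sum_set X' Y') = sum_set (sum_set X X') (sum_set Y Y')"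
proof -
  have "sum_set (sum_set X Y) (sum_set X' Y') \<subseteq> sum_set (sum_set X X') (sum_set Y Y')" for X Y X' Y'
  proof
    fix u assume "u \<in> sum_set (sum_set X Y) (sum_set X' Y')"
    then obtain x y x' y' where "x \<in> X" "y \<in> Y" "x' \<in> X'" "y' \<in> Y'" "u = (x + y) + (x' + y')"
      by (auto simp: sum_set_def)
    moreover from this have "u = (x + x') + (y + y')" by (simp add: add_ac)
    ultimately show "u \<in> sum_set (sum_set X X') (sum_set Y Y')"
      by (simp add: sum_set_memI)
  qed
  then show ?thesis by blast
qed

lemma sum_set_commute: "sum_set X Y = sum_set Y X"
proof -
  have "sum_set X Y \<subseteq> sum_set Y X" for X Y
  proof
    fix u assume "u \<in> sum_set X Y"
    then obtain x y where "x \<in> X" "y \<in> Y" "u = x + y" by (auto simp: sum_set_def)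
    then show "u \<in> sum_set Y X" using sum_set_memI[of y Y x X] by (simp add: add.commute)
  qed
  then show ?thesis by blast
qed

lemma image_sum_set_subset:
  assumes "Vector_Spaces.linear scl scl T" "T ` X \<subseteq> X'" "T ` Y \<subseteq> Y'"
  shows "T ` sum_set X Y \<subseteq> sum_set X' Y'"
proof -
  interpret t: Vector_Spaces.linear scl scl T by fact
  show ?thesis
  proof
    fix u assume "u \<in> T ` sum_set X Y"
    then obtain x y where "x \<in> X" "y \<in> Y" "u = T x + T y"
      by (auto simp: sum_set_def t.add)
    then show "u \<in> sum_set X' Y'" using assms(2,3) sum_set_memI[of "T x" X' "T y" Y'] by blast
  qed
qed

lemma sum_set_upper1: "subspace Y \<Longrightarrow> x \<in> X \<Longrightarrow> x \<in> sum_set X Y"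
  using sum_set_memI[of x X 0 Y] subspace_0 by simp

lemma sum_set_upper2: "subspace X \<Longrightarrow> y \<in> Y \<Longrightarrow> y \<in> sum_set X Y"
  using sum_set_memI[of 0 X y Y] subspace_0 by simp

lemma isotropic_sum_set:
  assumes "isotropic X" "isotropic Y" "\<And>x y. x \<in> X \<Longrightarrow> y \<in> Y \<Longrightarrow> B x y = 0"
  shows "isotropic (sum_set X Y)"
  unfolding isotropic_def sum_set_def
proof safe
  fix x y x' y' assume *: "x \<in> X" "y \<in> Y" "x' \<in> X" "y' \<in> Y"
  then have "B x x' = 0" "B y y' = 0" "B x y' = 0" "B x' y = 0"
    using assms by (auto simp: isotropic_def)
  then show "B (x + y) (x' + y') = 0"
    using B_zero_sym[of x' y] by (simp add: B_simps)
qed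

end

section \<open>Operators generated by a self-adjoint and a skew-adjoint one\<close>

text \<open>The intended operators are \<open>c = g + g\<^sup>-\<^sup>1\<close> and \<open>d = g - g\<^sup>-\<^sup>1\<close> for a symplectic \<open>g\<close>. An involution \<open>s\<close>
  conjugates \<open>g\<close> to its inverse iff it commutes with \<open>c\<close> and anticommutes with \<open>d\<close>, that is, iff \<open>c\<close>
  preserves the two eigenspaces of \<open>s\<close> and \<open>d\<close> maps each into the other. The relation for \<open>d (d x)\<close> says that
  \<open>d\<^sup>2\<close> lies in the algebra generated by \<open>c\<close>.\<close>

locale adjoint_pair = symplectic_space scl B n
  for scl :: "'a::field \<Rightarrow> 'w::ab_group_add \<Rightarrow> 'w" and B and n +
  fixes c d :: "'w \<Rightarrow> 'w"
  assumes two: "(2::'a) \<noteq> 0"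
    and c_linear: "Vector_Spaces.linear scl scl c"
    and d_linear: "Vector_Spaces.linear scl scl d"
    and c_selfadjoint: "B (c x) y = B x (c y)"
    and d_skewadjoint: "B (d x) y = - B x (d y)"
    and d_c: "d (c x) = c (d x)"
    and d_d: "d (d x) = c (c x) - scl 4 x"
begin

sublocale c: Vector_Spaces.linear scl scl c by (rule c_linear)
sublocale d: Vector_Spaces.linear scl scl d by (rule d_linear)

text \<open>\<open>act p\<close> is the operator \<open>p(c)\<close>.\<close>

definition act :: "'a poly \<Rightarrow> 'w \<Rightarrow> 'w" where
  "act p = fold_coeffs (\<lambda>a h x. scl a x + c (h x)) p (\<lambda>_. 0)"

lemma act_0 [simp]: "act 0 x = 0"
  by (simp add: act_def)

lemma act_pCons [simp]: "act (pCons a p) x = scl a x + c (act p x)"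
  by (cases "p = 0 \<and> a = 0") (auto simp: act_def c.zero)

lemma act_zero_right [simp]: "act p 0 = 0"
  by (induction p) (auto simp: c.zero)

lemma act_add_right: "act p (x + y) = act p x + act p y"
  by (induction p) (auto simp: c.add scale_right_distrib)

lemma act_scale_right: "act p (scl a x) = scl a (act p x)"
  by (induction p) (auto simp: c.scale scale_right_distrib mult.commute)

lemma act_linear: "Vector_Spaces.linear scl scl (act p)"
  by unfold_locales (auto simp: act_add_right act_scale_right)

lemma act_c: "act p (c x) = c (act p x)"
  by (induction p) (auto simp: c.add c.scale)

lemma act_d: "act p (d x) = d (act p x)"
  by (induction p) (auto simp: d.add d.scale d_c d.zero)

lemma act_add: "act (p + q) x = act p x + act q x"
  by (induction p q rule: poly_induct2) (auto simp: c.add scale_left_distrib)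

lemma act_smult: "act (smult a p) x = scl a (act p x)"
  by (induction p) (auto simp: c.scale scale_right_distrib)

lemma act_minus: "act (- p) x = - act p x"
  using act_smult[of "-1" p x] by simp

lemma act_diff: "act (p - q) x = act p x - act q x"
  using act_add[of p "- q" x] by (simp add: act_minus)

lemma act_mult: "act (p * q) x = act p (act q x)"
  by (induction p) (auto simp: act_add act_smult)

lemma act_1 [simp]: "act 1 x = x"
  by (simp add: one_pCons c.zero)

lemma act_commute: "act p (act q x) = act q (act p x)"
  by (metis act_mult mult.commute)

lemma act_selfadjoint: "B (act p x) y = B x (act p y)"
  by (induction p arbitrary: x y) (auto simp: B_simps c_selfadjoint act_c)

lemma act_d_skewadjoint: "B (act p (d x)) y = - B x (act p (d y))"
  by (simp add: act_selfadjoint d_skewadjoint act_d)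

lemma d_d_act: "d (d x) = act [:-4, 0, 1:] x"
  by (simp add: d_d c.zero c.add)

definition stable :: "'w set \<Rightarrow> bool" where
  "stable U \<longleftrightarrow> subspace U \<and> c ` U \<subseteq> U \<and> d ` U \<subseteq> U"

text \<open>Regular subspaces are the orthogonal direct summands that \<open>c\<close> and \<open>d\<close> respect; see
  \<open>orthogonal_splitting\<close>.\<close>

definition regular :: "'w set \<Rightarrow> bool" where
  "regular U \<longleftrightarrow> stable U \<and> nondegenerate_on U"

text \<open>Such a pair is what remains of the desired involution once it is described by its eigenspaces for
  the eigenvalues \<open>1\<close> and \<open>-1\<close>. In this form, involutions on orthogonal summands are glued by adding
  subspaces, and no map has to be defined on a part of the space.\<close>

definition lagrangian_pair :: "'w set \<Rightarrow> 'w set \<Rightarrow> 'w set \<Rightarrow> bool" where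
  "lagrangian_pair U Lp Lm \<longleftrightarrow> subspace Lp \<and> subspace Lm \<and> isotropic Lp \<and> isotropic Lm \<and>
     U = sum_set Lp Lm \<and> c ` Lp \<subseteq> Lp \<and> c ` Lm \<subseteq> Lm \<and> d ` Lp \<subseteq> Lm \<and> d ` Lm \<subseteq> Lp"

lemma act_mem: "subspace U \<Longrightarrow> c ` U \<subseteq> U \<Longrightarrow> x \<in> U \<Longrightarrow> act p x \<in> U"
  by (induction p) (auto intro!: subspace_add subspace_scale subspace_0)

text \<open>The adjoints of \<open>c\<close> and \<open>d\<close> are \<open>c\<close> and \<open>-d\<close>, so the orthogonal complement of a regular subspace is
  again stable.\<close>

lemma orthogonal_splitting:
  assumes U: "regular U" and R: "regular R" "R \<subseteq> U"
  defines "Q \<equiv> {x \<in> U. \<forall>y\<in>R. B x y = 0}"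
  shows "regular Q" and "U = sum_set R Q"
proof -
  have sU: "subspace U" and sR: "subspace R" and cU: "c ` U \<subseteq> U" and dU: "d ` U \<subseteq> U"
    and cR: "c ` R \<subseteq> R" and dR: "d ` R \<subseteq> R"
    using U R by (auto simp: regular_def stable_def)
  have sQ: "subspace Q"
    using sU unfolding Q_def subspace_def by (auto simp: B_simps)
  have cQ: "c ` Q \<subseteq> Q" and dQ: "d ` Q \<subseteq> Q"
    using cU dU cR dR unfolding Q_def by (auto simp: c_selfadjoint d_skewadjoint)
  show eq: "U = sum_set R Q"
  proof
    show "U \<subseteq> sum_set R Q"
    proof
      fix x assume x: "x \<in> U"
      obtain y where y: "y \<in> R" "\<forall>w\<in>R. B (x - y) w = 0"
        using orthogonal_projection[of R x] R sR by (auto simp: regular_def)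
      then have "x - y \<in> Q" using x sU R(2) by (auto simp: Q_def intro: subspace_diff)
      then show "x \<in> sum_set R Q" using sum_set_memI[OF y(1), of "x - y" Q] by simp
    qed
    show "sum_set R Q \<subseteq> U"
      using R(2) sU by (auto simp: sum_set_def Q_def intro!: subspace_add)
  qed
  have "nondegenerate_on Q"
    unfolding nondegenerate_on_def
  proof (intro ballI impI)
    fix x assume x: "x \<in> Q" "\<forall>y\<in>Q. B x y = 0"
    have "B x u = 0" if u: "u \<in> U" for u
    proof -
      obtain r q where "r \<in> R" "q \<in> Q" "u = r + q"
        using u unfolding eq sum_set_def by blast
      then show ?thesis using x by (simp add: B_simps Q_def)
    qed
    then show "x = 0" using U x(1) by (auto simp: regular_def nondegenerate_on_def Q_def)
  qed
  then show "regular Q" using sQ cQ dQ by (simp add: regular_def stable_def)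
qed

lemma lagrangian_pair_sum:
  assumes R: "lagrangian_pair R Lp Lm" and Q: "lagrangian_pair Q Mp Mm"
    and orth: "\<And>x y. x \<in> R \<Longrightarrow> y \<in> Q \<Longrightarrow> B x y = 0"
  shows "lagrangian_pair (sum_set R Q) (sum_set Lp Mp) (sum_set Lm Mm)"
proof -
  have sub: "subspace Lp" "subspace Lm" "subspace Mp" "subspace Mm"
    using R Q by (auto simp: lagrangian_pair_def)
  have inR: "Lp \<subseteq> R" "Lm \<subseteq> R" and inQ: "Mp \<subseteq> Q" "Mm \<subseteq> Q"
    using R Q sub sum_set_upper1 sum_set_upper2 by (auto simp: lagrangian_pair_def)
  have iso: "isotropic (sum_set L M)"
    if "isotropic L" "isotropic M" "L \<subseteq> R" "M \<subseteq> Q" for L M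
    using that(3,4) orth by (intro isotropic_sum_set that(1,2)) blast
  have "sum_set R Q = sum_set (sum_set Lp Mp) (sum_set Lm Mm)"
  proof -
    have "R = sum_set Lp Lm" "Q = sum_set Mp Mm"
      using R Q by (auto simp: lagrangian_pair_def)
    then show ?thesis by (simp add: sum_set_interchange)
  qed
  moreover have "c ` sum_set Lp Mp \<subseteq> sum_set Lp Mp" "c ` sum_set Lm Mm \<subseteq> sum_set Lm Mm"
    "d ` sum_set Lp Mp \<subseteq> sum_set Lm Mm" "d ` sum_set Lm Mm \<subseteq> sum_set Lp Mp"
    using R Q unfolding lagrangian_pair_def
    by (intro image_sum_set_subset c_linear d_linear; simp)+
  moreover have "isotropic (sum_set Lp Mp)" "isotropic (sum_set Lm Mm)"
    using R Q inR inQ by (auto intro!: iso simp: lagrangian_pair_def)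
  ultimately show ?thesis
    using sub by (simp add: lagrangian_pair_def subspace_sum_set)
qed

text \<open>This is Fitting's lemma for a self-adjoint operator \<open>T = p(c)\<close>: for large \<open>m\<close> the kernel and the image
  of \<open>T\<^sup>m\<close> are orthogonal complements of each other, so the image is regular. If \<open>U\<close> has no regular
  subspaces besides \<open>0\<close> and itself, one of the two is zero.\<close>

lemma selfadjoint_nilpotent_or_injective:
  assumes U: "regular U" and min: "\<And>R. regular R \<Longrightarrow> R \<subseteq> U \<Longrightarrow> R = {0} \<or> R = U"
  shows "(\<forall>x\<in>U. act p x = 0 \<longrightarrow> x = 0) \<or> (\<exists>k. \<forall>x\<in>U. act (p ^ k) x = 0)"
proof -
  have sU: "subspace U" and cU: "c ` U \<subseteq> U" and dU: "d ` U \<subseteq> U" and ndU: "nondegenerate_on U"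
    using U by (auto simp: regular_def stable_def)
  \<comment> \<open>A power with image of least dimension maps that image onto itself.\<close>
  obtain k where k: "\<And>j. dim (act (p ^ Suc k) ` U) \<le> dim (act (p ^ Suc j) ` U)"
    using ex_has_least_nat[of "\<lambda>_. True" 0 "\<lambda>j. dim (act (p ^ Suc j) ` U)"] by auto
  define q where "q = p ^ Suc k"
  define R where "R = act q ` U"
  interpret q: Vector_Spaces.linear scl scl "act q" by (rule act_linear)
  have RU: "R \<subseteq> U" using act_mem[OF sU cU] by (auto simp: R_def)
  have sR: "subspace R" unfolding R_def using q.subspace_image sU by blast
  have "act q ` R = act (p ^ Suc (Suc (2 * k))) ` U"
    by (simp add: R_def image_image flip: act_mult) (simp add: q_def mult_2 power_add mult_ac power2_eq_square power_mult)
  then have "dim R \<le> dim (act q ` R)" using k[of "Suc (2 * k)"] by (simp add: R_def q_def)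
  moreover have "subspace (act q ` R)" using q.subspace_image sR by blast
  moreover have "act q ` R \<subseteq> R" using RU by (auto simp: R_def)
  ultimately have qR: "act q ` R = R"
    using psubspace_dim_less[of "act q ` R" R] sR by (metis leD psubsetI)
  have "nondegenerate_on R"
    unfolding nondegenerate_on_def
  proof (intro ballI impI)
    fix x assume x: "x \<in> R" "\<forall>y\<in>R. B x y = 0"
    obtain z where z: "z \<in> U" "x = act q z" using x by (auto simp: R_def)
    have "B x u = 0" if u: "u \<in> U" for u
    proof -
      \<comment> \<open>Since \<open>act q\<close> maps \<open>R\<close> onto itself, \<open>u\<close> is an element of \<open>R\<close> plus one of the kernel of \<open>act q\<close>.\<close>
      have "act q u \<in> R" unfolding R_def using u by blast
      then have "act q u \<in> act q ` R" by (simp only: qR)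
      then obtain r where r: "r \<in> R" "act q u = act q r" by auto
      then have "act q (u - r) = 0" by (simp add: q.diff)
      then have "B x (u - r) = 0" by (simp only: z(2) act_selfadjoint B_zero_right)
      then show ?thesis using x(2) r(1) by (simp add: B_simps)
    qed
    then show "x = 0" using ndU x(1) RU by (auto simp: nondegenerate_on_def)
  qed
  moreover have "c ` R \<subseteq> R" "d ` R \<subseteq> R"
    using cU dU by (auto simp: R_def simp flip: act_c act_d)
  ultimately have "regular R" using sR by (simp add: regular_def stable_def)
  then consider "R = {0}" | "R = U" using min RU by blast
  then show ?thesis
  proof cases
    case 1
    then have "\<forall>x\<in>U. act (p ^ Suc k) x = 0" by (auto simp: R_def q_def)
    then show ?thesis by blast
  next
    case 2
    have "x = 0" if x: "x \<in> U" "act p x = 0" for x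
    proof -
      have "act q x = act (p ^ k) (act p x)" by (simp add: q_def power_commutes flip: act_mult)
      then have qx: "act q x = 0" using x by simp
      have "B x u = 0" if "u \<in> U" for u
      proof -
        obtain v where "u = act q v" using \<open>u \<in> U\<close> 2 by (auto simp: R_def)
        then show ?thesis using qx by (simp add: B_simps flip: act_selfadjoint)
      qed
      then show ?thesis using ndU x(1) by (auto simp: nondegenerate_on_def)
    qed
    then show ?thesis by blast
  qed
qed

text \<open>Otherwise the vectors \<open>p(c) v\<close> with \<open>degree p < m\<close> would form an infinite strictly increasing chain of
  subspaces.\<close>

lemma ex_annihilating_poly: "\<exists>p. p \<noteq> 0 \<and> act p v = 0"
proof (rule ccontr)
  assume *: "\<nexists>p. p \<noteq> 0 \<and> act p v = 0"
  define S where "S m = (\<lambda>p. act p v) ` {p. p = 0 \<or> degree p < m}" for m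
  have sub: "subspace (S m)" for m
  proof -
    have "act p v + act q v \<in> S m" if "p = 0 \<or> degree p < m" "q = 0 \<or> degree q < m" for p q
      using that degree_add_less[of p m q] unfolding S_def
      by (intro image_eqI[of _ _ "p + q"]) (auto simp: act_add)
    moreover have "scl a (act p v) \<in> S m" if "p = 0 \<or> degree p < m" for a p
      using that degree_smult_le[of a p] unfolding S_def
      by (intro image_eqI[of _ _ "smult a p"]) (auto simp: act_smult)
    moreover have "0 \<in> S m" unfolding S_def by (intro image_eqI[of _ _ 0]) auto
    ultimately show ?thesis unfolding subspace_def by (auto simp: S_def)
  qed
  have "S m \<subset> S (Suc m)" for m
  proof -
    have "act (monom 1 m) v \<notin> S m"
    proof
      assume "act (monom 1 m) v \<in> S m"
      then obtain p where p: "p = 0 \<or> degree p < m" "act (monom 1 m) v = act p v"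
        by (auto simp: S_def)
      have "monom 1 m \<noteq> p" using p(1) by (auto simp: degree_monom_eq)
      then have "monom 1 m - p \<noteq> 0" by simp
      moreover have "act (monom 1 m - p) v = 0" using p(2) by (simp add: act_diff)
      ultimately show False using * by blast
    qed
    moreover have "act (monom 1 m) v \<in> S (Suc m)"
      unfolding S_def by (intro imageI) (simp add: degree_monom_eq)
    moreover have "S m \<subseteq> S (Suc m)" unfolding S_def by (intro image_mono) auto
    ultimately show ?thesis by blast
  qed
  then have "dim (S m) < dim (S (Suc m))" for m by (intro psubspace_dim_less sub)
  then have m: "m \<le> dim (S m)" for m
    by (induction m) (auto simp: Suc_le_eq intro: le_less_trans)
  have "dim (S m) \<le> dim UNIV" for m
    using psubspace_dim_less[OF sub[of m], of UNIV] by (cases "S m = UNIV") (auto simp: psubset_eq)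
  then show False using m[of "Suc (dim UNIV)"] by (meson not_less_eq_eq order_trans)
qed

text \<open>The submodule generated by \<open>v\<close> over the algebra of the polynomials in \<open>c\<close>, without \<open>d\<close>.\<close>

definition cyclic_submodule :: "'w \<Rightarrow> 'w set" where
  "cyclic_submodule v = range (\<lambda>p. act p v)"

lemma act_in_cyclic_submodule: "act p v \<in> cyclic_submodule v"
  by (auto simp: cyclic_submodule_def)

lemma self_in_cyclic_submodule: "v \<in> cyclic_submodule v"
  using act_in_cyclic_submodule[of 1 v] by simp

lemma subspace_cyclic_submodule: "subspace (cyclic_submodule v)"
proof -
  have "act p v + act q v \<in> cyclic_submodule v" "scl a (act p v) \<in> cyclic_submodule v" for p q a
    using act_in_cyclic_submodule[of "p + q" v] act_in_cyclic_submodule[of "smult a p" v]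
    by (simp_all add: act_add act_smult)
  moreover have "0 \<in> cyclic_submodule v" using act_in_cyclic_submodule[of 0 v] by simp
  ultimately show ?thesis unfolding subspace_def by (auto simp: cyclic_submodule_def)
qed

lemma c_cyclic_submodule: "c ` cyclic_submodule v \<subseteq> cyclic_submodule v"
proof -
  have "c (act p v) \<in> cyclic_submodule v" for p
    using act_in_cyclic_submodule[of "pCons 0 p" v] by simp
  then show ?thesis by (auto simp: cyclic_submodule_def)
qed

lemma d_cyclic_submodule: "d ` cyclic_submodule v \<subseteq> cyclic_submodule (d v)"
  by (auto simp: cyclic_submodule_def simp flip: act_d)

lemma d_cyclic_submodule_d: "d ` cyclic_submodule (d v) \<subseteq> cyclic_submodule v"
proof -
  have "d (act p (d v)) \<in> cyclic_submodule v" for p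
    using act_in_cyclic_submodule[of "p * [:-4, 0, 1:]" v] by (simp only: act_mult d_d_act flip: act_d)
  then show ?thesis by (auto simp: cyclic_submodule_def)
qed

lemma cyclic_submodule_subset: "stable U \<Longrightarrow> v \<in> U \<Longrightarrow> cyclic_submodule v \<subseteq> U"
  by (auto simp: cyclic_submodule_def stable_def intro: act_mem)

lemma cyclic_submodule_orthogonal:
  assumes "\<And>p. B v (act p w) = 0" "x \<in> cyclic_submodule v" "y \<in> cyclic_submodule w"
  shows "B x y = 0"
proof -
  obtain p q where "x = act p v" "y = act q w" using assms by (auto simp: cyclic_submodule_def)
  then show ?thesis using assms(1)[of "p * q"] by (simp add: act_selfadjoint act_mult)
qed

text \<open>All operators \<open>p(c)\<close> are self-adjoint for an alternating form: \<open>B v (p(c) v)\<close> equals its own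
  negative.\<close>

lemma isotropic_cyclic_submodule: "isotropic (cyclic_submodule v)"
proof -
  have "B v (act p v) = 0" for p
    using B_skew[of v "act p v"] by (intro eq_minus_self_imp_zero[OF two]) (simp add: act_selfadjoint)
  then show ?thesis using cyclic_submodule_orthogonal[of v v] by (simp add: isotropic_def)
qed

end

section \<open>Lagrangian pairs on orthogonally indecomposable blocks\<close>

text \<open>A nonzero regular \<open>U\<close> whose only regular subspaces are \<open>0\<close> and itself is a primary module over the
  polynomials in \<open>c\<close>: there is an irreducible \<open>f\<close> such that every polynomial acts on \<open>U\<close> as a power of \<open>f\<close>
  times an injective operator. Irreducibility of \<open>f\<close> is expressed by the axiom \<open>injective\<close>, the form in which
  it is used. The image of \<open>f\<^sup>k(c)\<close> lies in every nonzero submodule of a cyclic module on which it is not zero;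
  nondegeneracy will be tested on it.\<close>

locale primary_block = adjoint_pair scl B n c d
  for scl :: "'a::field \<Rightarrow> 'w::ab_group_add \<Rightarrow> 'w" and B and n and c d +
  fixes U :: "'w set" and f :: "'a poly" and k :: nat
  assumes regular_U: "regular U"
    and minimal: "regular R \<Longrightarrow> R \<subseteq> U \<Longrightarrow> R = {0} \<or> R = U"
    and injective: "\<not> f dvd p \<Longrightarrow> x \<in> U \<Longrightarrow> act p x = 0 \<Longrightarrow> x = 0"
    and nilpotent: "x \<in> U \<Longrightarrow> act (f ^ Suc k) x = 0"
    and socle_nonzero: "\<exists>x\<in>U. act (f ^ k) x \<noteq> 0"
begin

lemma stable_U: "stable U" and subspace_U: "subspace U"
  and d_U: "x \<in> U \<Longrightarrow> d x \<in> U" and act_U: "x \<in> U \<Longrightarrow> act p x \<in> U"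
  and nondegenerate_U: "nondegenerate_on U"
  using regular_U by (auto simp: regular_def stable_def intro: act_mem)

lemma ex_killed: "\<exists>x\<in>U. x \<noteq> 0 \<and> act f x = 0"
proof -
  obtain x where "x \<in> U" "act (f ^ k) x \<noteq> 0" using socle_nonzero by blast
  then show ?thesis
    using nilpotent[of x] by (intro bexI[of _ "act (f ^ k) x"]) (auto simp: act_U act_mult)
qed

lemma not_dvd_mult:
  assumes "\<not> f dvd p" "\<not> f dvd q" shows "\<not> f dvd p * q"
proof
  assume "f dvd p * q"
  then obtain r where r: "p * q = r * f" by (metis dvd_def mult.commute)
  obtain x where x: "x \<in> U" "x \<noteq> 0" "act f x = 0" using ex_killed by blast
  have "act p (act q x) = act (r * f) x" by (simp add: act_mult flip: r)
  then have "act p (act q x) = 0" using x by (simp add: act_mult)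
  then show False using injective assms x act_U by blast
qed

text \<open>An injective operator maps the finite-dimensional space \<open>R\<close> onto itself, so it has an inverse there.\<close>

lemma reflects_membership:
  assumes q: "\<not> f dvd q" and R: "stable R" "R \<subseteq> U" and x: "x \<in> U" "act q x \<in> R"
  shows "x \<in> R"
proof -
  interpret q: Vector_Spaces.linear scl scl "act q" by (rule act_linear)
  have "act q ` R = R"
    using R q injective act_mem
    by (intro linear_on_subspace_inj_imp_surj act_linear) (auto simp: stable_def)
  then obtain r where r: "r \<in> R" "act q x = act q r" using x(2) by (metis imageE)
  then have "act q (x - r) = 0" "x - r \<in> U"
    using R x subspace_U by (auto simp: q.diff intro: subspace_diff)
  then have "x - r = 0" using injective q by blast
  then show ?thesis using r by simp
qed

lemma factorization: "\<exists>j q. p = f ^ j * q \<and> j \<le> Suc k \<and> (j \<le> k \<longrightarrow> \<not> f dvd q)"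
proof -
  have "\<exists>j q. p = f ^ j * q \<and> j \<le> m \<and> (j < m \<longrightarrow> \<not> f dvd q)" for m
  proof (induction m)
    case 0
    show ?case by (intro exI[of _ 0] exI[of _ p]) simp
  next
    case (Suc m)
    then obtain j q where jq: "p = f ^ j * q" "j \<le> m" "j < m \<longrightarrow> \<not> f dvd q" by blast
    show ?case
    proof (cases "f dvd q")
      case True
      then obtain r where "q = f * r" by blast
      then show ?thesis using True jq
        by (intro exI[of _ "Suc m"] exI[of _ r]) (auto simp: mult_ac)
    next
      case False
      then show ?thesis using jq by (intro exI[of _ j] exI[of _ q]) auto
    qed
  qed
  then show ?thesis by (metis less_Suc_eq_le)
qed

lemma nilpotent_ge: "x \<in> U \<Longrightarrow> k < j \<Longrightarrow> act (f ^ j) x = 0"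
  using nilpotent[of x] by (metis Suc_leI act_mult act_zero_right le_add_diff_inverse2 power_add)

text \<open>A cyclic module over a uniserial ring has a smallest nonzero submodule: dividing \<open>p\<close> by its injective
  factor and multiplying by a power of \<open>f\<close> turns any nonzero element \<open>p(c) x\<close> into \<open>f\<^sup>k(c) x\<close>.\<close>

lemma socle_in_submodule:
  assumes R: "stable R" "R \<subseteq> U" and x: "x \<in> U" "act p x \<in> R" "act p x \<noteq> 0"
  shows "act (f ^ k) x \<in> R"
proof -
  obtain j q where p: "p = f ^ j * q" "j \<le> Suc k" "j \<le> k \<longrightarrow> \<not> f dvd q"
    using factorization[of p] by blast
  have j: "j \<le> k"
  proof (rule ccontr)
    assume "\<not> j \<le> k"
    then have "act p x = 0" unfolding p(1) using x act_U by (simp add: act_mult nilpotent_ge)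
    then show False using x by simp
  qed
  have "act q (act (f ^ j) x) \<in> R" using x(2) p(1) by (simp add: act_mult act_commute)
  then have "act (f ^ j) x \<in> R" using reflects_membership[of q R] p(3) j R x act_U by blast
  then have "act (f ^ (k - j)) (act (f ^ j) x) \<in> R"
    using R by (auto simp: stable_def intro: act_mem)
  then show ?thesis using j by (simp flip: act_mult power_add)
qed

text \<open>As \<open>U\<close> is its only nonzero regular subspace, a pair of isotropic subspaces fills \<open>U\<close> as soon as its sum is
  nonzero and has no radical. As both subspaces are isotropic, the radical is the sum of its
  intersections with them, so only vectors in one of the two need to be tested.\<close>

lemma lagrangian_pairI:
  assumes L: "subspace Lp" "subspace Lm" "Lp \<subseteq> U" "Lm \<subseteq> U" "isotropic Lp" "isotropic Lm"
      "c ` Lp \<subseteq> Lp" "c ` Lm \<subseteq> Lm" "d ` Lp \<subseteq> Lm" "d ` Lm \<subseteq> Lp"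
    and v: "v \<in> Lp" "v \<noteq> 0"
    and radical: "\<And>R x. stable R \<Longrightarrow> R \<subseteq> U \<Longrightarrow> (\<And>r y. r \<in> R \<Longrightarrow> y \<in> Lp \<union> Lm \<Longrightarrow> B r y = 0) \<Longrightarrow>
      x \<in> R \<Longrightarrow> x \<in> Lp \<union> Lm \<Longrightarrow> x = 0"
  shows "lagrangian_pair U Lp Lm"
proof -
  let ?S = "sum_set Lp Lm"
  have stS: "stable ?S" unfolding stable_def
  proof (intro conjI)
    show "subspace ?S" using L by (simp add: subspace_sum_set)
    show "c ` ?S \<subseteq> ?S" using L by (intro image_sum_set_subset c_linear) auto
    have "d ` ?S \<subseteq> sum_set Lm Lp" using L by (intro image_sum_set_subset d_linear) auto
    then show "d ` ?S \<subseteq> ?S" by (simp only: sum_set_commute[of Lm])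
  qed
  have SU: "?S \<subseteq> U" using L subspace_U by (auto simp: sum_set_def intro!: subspace_add)
  define R where "R = {x \<in> ?S. \<forall>y\<in>Lp \<union> Lm. B x y = 0}"
  have stR: "stable R"
    unfolding stable_def
  proof (intro conjI)
    show "subspace R" using stS unfolding R_def stable_def subspace_def by (auto simp: B_simps)
    show "c ` R \<subseteq> R" using stS L(7,8) by (auto simp: R_def stable_def c_selfadjoint)
    show "d ` R \<subseteq> R" using stS L(9,10) by (auto simp: R_def stable_def d_skewadjoint)
  qed
  have RU: "R \<subseteq> U" and Rorth: "\<And>r y. r \<in> R \<Longrightarrow> y \<in> Lp \<union> Lm \<Longrightarrow> B r y = 0"
    using SU by (auto simp: R_def)
  have inS: "x \<in> ?S" if "x \<in> Lp \<union> Lm" for x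
    using that L by (auto intro: sum_set_upper1 sum_set_upper2)
  have "nondegenerate_on ?S"
    unfolding nondegenerate_on_def
  proof (intro ballI impI)
    fix x assume x: "x \<in> ?S" "\<forall>y\<in>?S. B x y = 0"
    then obtain y z where yz: "y \<in> Lp" "z \<in> Lm" "x = y + z" by (auto simp: sum_set_def)
    have "B y u = 0 \<and> B z u = 0" if "u \<in> Lp \<union> Lm" for u
    proof -
      have "B x u = 0" using x inS that by blast
      moreover have "B y u = 0 \<or> B z u = 0" using that yz L(5,6) by (auto simp: isotropic_def)
      ultimately show ?thesis using yz(3) by (auto simp: B_simps)
    qed
    then have "y \<in> R" "z \<in> R" using yz inS by (auto simp: R_def)
    then have "y = 0" "z = 0" using radical[OF stR RU Rorth] yz by auto
    then show "x = 0" using yz by simp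
  qed
  then have "regular ?S" using stS by (simp add: regular_def)
  moreover have "?S \<noteq> {0}" using inS v by blast
  ultimately have "U = ?S" using minimal SU by blast
  then show ?thesis using L by (simp add: lagrangian_pair_def)
qed

text \<open>Here \<open>U\<close> turns out to be generated by \<open>v\<close> over \<open>c\<close> and \<open>d\<close>. A nonzero radical would contain the socle
  element \<open>f\<^sup>k(c) v\<close> or \<open>f\<^sup>k(c) d v\<close>, and the hypothesis says that these do pair nontrivially.\<close>

lemma cyclic_case:
  assumes v: "v \<in> U" "B (act (f ^ k) v) (d v) \<noteq> 0"
  shows "lagrangian_pair U (cyclic_submodule v) (cyclic_submodule (d v))"
proof (rule lagrangian_pairI[where v = v])
  show "v \<noteq> 0" using v by (auto simp: B_simps)
  fix R x
  assume R: "stable R" "R \<subseteq> U" and orth: "\<And>r y. r \<in> R \<Longrightarrow> y \<in> cyclic_submodule v \<union> cyclic_submodule (d v) \<Longrightarrow> B r y = 0"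
    and x: "x \<in> R" "x \<in> cyclic_submodule v \<union> cyclic_submodule (d v)"
  have "act (f ^ k) v \<notin> R" using orth self_in_cyclic_submodule v(2) by blast
  moreover have "act (f ^ k) (d v) \<notin> R"
  proof
    assume "act (f ^ k) (d v) \<in> R"
    then have "B (act (f ^ k) (d v)) v = 0" using orth self_in_cyclic_submodule by blast
    then show False using v(2) by (simp add: act_d_skewadjoint flip: act_selfadjoint)
  qed
  ultimately show "x = 0"
    using x socle_in_submodule[OF R] v d_U by (auto simp: cyclic_submodule_def)
qed (use v d_U in \<open>auto simp: subspace_cyclic_submodule isotropic_cyclic_submodule self_in_cyclic_submodule
      intro: subsetD[OF cyclic_submodule_subset[OF stable_U]] subsetD[OF c_cyclic_submodule] subsetD[OF d_cyclic_submodule] subsetD[OF d_cyclic_submodule_d]\<close>)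

text \<open>If \<open>f\<^sup>k(c) d = 0\<close>, then \<open>d\<^sup>2\<close> is \<open>f(c)\<close> up to an injective operator and \<open>d\<close> acts like a square root
  of \<open>f(c)\<close>. Count \<open>f\<close> with weight 2 and \<open>d\<close> with weight 1: the two summands below have even and odd weights,
  hence different ones. Multiplying by the operator that lifts the smaller weight to \<open>2 * k\<close> kills the other
  summand and leaves the socle element of \<open>v\<close> or of \<open>w\<close>, which \<open>R\<close> does not contain. Summands of weight above
  \<open>2 * k\<close> are zero.\<close>

lemma radical_in_bicyclic_case:
  assumes dd: "[:-4, 0, 1:] = f * h" "\<not> f dvd h"
    and fd: "\<And>y. y \<in> U \<Longrightarrow> act (f ^ k) (d y) = 0"
    and R: "stable R" "R \<subseteq> U" and v: "v \<in> U" "act (f ^ k) v \<notin> R" and w: "w \<in> U" "act (f ^ k) w \<notin> R"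
    and x: "act a v + act b (d w) \<in> R"
  shows "act a v + act b (d w) = 0"
proof -
  obtain i a' where a: "a = f ^ i * a'" "i \<le> Suc k" "i \<le> k \<longrightarrow> \<not> f dvd a'"
    using factorization[of a] by blast
  obtain j b' where b: "b = f ^ j * b'" "j \<le> Suc k" "j \<le> k \<longrightarrow> \<not> f dvd b'"
    using factorization[of b] by blast
  have kill_d: "act (f ^ m * q) (d y) = 0" if "k \<le> m" "y \<in> U" for m q y
  proof -
    have e: "f ^ m * q = (f ^ (m - k) * q) * f ^ k" using that(1) by (simp add: mult_ac flip: power_add)
    show ?thesis unfolding e using fd that(2) by (simp add: act_mult)
  qed
  have act_R: "act q y \<in> R" if "y \<in> R" for q y using R that by (auto simp: stable_def intro: act_mem)
  have d_R: "d y \<in> R" if "y \<in> R" for y using R that by (auto simp: stable_def)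
  have d_sum: "d (act a v + act b (d w)) = act a (d v) + act (b * (f * h)) w"
    by (simp add: d.add act_mult d_d_act dd(1) flip: act_d)
  consider "i \<le> k" "i \<le> j" | "j < k" "j < i" | "i = Suc k" "k \<le> j"
    using a(2) b(2) by linarith
  then show ?thesis
  proof cases
    case 1
    have "act (f ^ (k - i)) (act a v + act b (d w))
        = act (f ^ (k - i) * a) v + act (f ^ (k - i) * b) (d w)"
      by (simp add: act_add_right act_mult)
    also have "f ^ (k - i) * a = a' * f ^ k" using 1 by (simp add: a(1) mult_ac flip: power_add)
    also have "f ^ (k - i) * b = f ^ (k - i + j) * b'" by (simp add: b(1) mult_ac power_add)
    also have "act \<dots> (d w) = 0" using 1 w by (intro kill_d) auto
    finally have "act a' (act (f ^ k) v) \<in> R" using act_R[OF x, of "f ^ (k - i)"] by (simp add: act_mult)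
    then have "act (f ^ k) v \<in> R"
      using reflects_membership[OF a(3)[rule_format, OF 1(1)] R] act_U v by blast
    then show ?thesis using v by blast
  next
    case 2
    have "act (f ^ (k - Suc j)) (d (act a v + act b (d w)))
        = act (f ^ (k - Suc j) * a) (d v) + act (f ^ (k - Suc j) * (b * (f * h))) w"
      by (simp add: act_add_right act_mult d_sum)
    also have "f ^ (k - Suc j) * a = f ^ (k - Suc j + i) * a'" by (simp add: a(1) mult_ac power_add)
    also have "act \<dots> (d v) = 0" using 2 v by (intro kill_d) auto
    also have "f ^ (k - Suc j) * (b * (f * h)) = (b' * h) * (f ^ (k - Suc j) * f ^ Suc j)"
      by (simp add: b(1) mult_ac)
    also have "f ^ (k - Suc j) * f ^ Suc j = f ^ k" using 2 by (simp only: flip: power_add) simp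
    finally have "act (b' * h) (act (f ^ k) w) \<in> R"
      using act_R[OF d_R[OF x], of "f ^ (k - Suc j)"] by (simp add: act_mult)
    then have "act (f ^ k) w \<in> R"
      using reflects_membership[OF not_dvd_mult[OF b(3)[rule_format] dd(2)] R] act_U w 2 by auto
    then show ?thesis using w by blast
  next
    case 3
    have "act a v = act (f ^ Suc k) (act a' v)" by (simp only: a(1) 3 act_mult)
    also have "\<dots> = 0" using v act_U by (intro nilpotent)
    finally have "act a v = 0" .
    moreover have "act b (d w) = 0" using 3 w unfolding b(1) by (intro kill_d) auto
    ultimately show ?thesis by simp
  qed
qed

text \<open>In this case the form \<open>B (f\<^sup>k(c) x) (d y)\<close> vanishes and \<open>U\<close> needs two generators. The vector \<open>w\<close> is
  chosen to be orthogonal to the whole submodule of \<open>d v\<close> and to pair nontrivially with the socle of \<open>v\<close>;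
  the first makes the two sums isotropic, the second makes their sum nondegenerate.\<close>

lemma bicyclic_case:
  assumes dd: "[:-4, 0, 1:] = f * h" "\<not> f dvd h"
    and fd: "\<And>y. y \<in> U \<Longrightarrow> act (f ^ k) (d y) = 0"
  shows "\<exists>Lp Lm. lagrangian_pair U Lp Lm"
proof -
  obtain v where v: "v \<in> U" "act (f ^ k) v \<noteq> 0" using socle_nonzero by blast
  have "act (f ^ k) v \<notin> cyclic_submodule (d v)"
  proof
    assume "act (f ^ k) v \<in> cyclic_submodule (d v)"
    then obtain p where p: "act (f ^ k) v = act p (d v)" by (auto simp: cyclic_submodule_def)
    obtain j q where q: "p = f ^ j * q" "j \<le> Suc k" "j \<le> k \<longrightarrow> \<not> f dvd q"
      using factorization[of p] by blast
    show False
    \<comment> \<open>Either \<open>p(c) d v\<close> is already zero, or applying \<open>d\<close> shows that \<open>f\<^sup>k(c)\<close> kills \<open>v\<close>.\<close>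
    proof (cases "k \<le> j")
      case True
      then have "p = (f ^ (j - k) * q) * f ^ k" by (simp add: q(1) mult_ac flip: power_add)
      then show False using p v fd by (simp add: act_mult)
    next
      case False
      have "act ((q * h) * f ^ Suc j) v = d (act p (d v))"
        by (simp add: q(1) d_d_act dd(1) mult_ac flip: act_mult act_d)
      also have "\<dots> = act (f ^ k) (d v)" by (simp only: p[symmetric]) (simp only: act_d)
      also have "\<dots> = 0" by (rule fd[OF v(1)])
      finally have "act (f ^ Suc j) v = 0"
        using injective[OF not_dvd_mult[OF q(3)[rule_format] dd(2)]] False v act_U by (simp add: act_mult)
      moreover have "f ^ k = f ^ (k - Suc j) * f ^ Suc j"
        using False by (simp only: flip: power_add) simp
      ultimately show False using v(2) by (simp only: act_mult) simp
    qed
  qed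
  then obtain w where w: "w \<in> U" "\<forall>z\<in>cyclic_submodule (d v). B z w = 0" "B (act (f ^ k) v) w \<noteq> 0"
    using separate_from_subspace[OF nondegenerate_U subspace_U subspace_cyclic_submodule[of "d v"]
        cyclic_submodule_subset[OF stable_U d_U[OF v(1)]] act_U[OF v(1)]] by blast
  have w': "B (act (f ^ k) w) v \<noteq> 0"
    using w(3) B_skew[of "act (f ^ k) w" v] by (simp add: act_selfadjoint)
  have orth_wdv: "B w (act p (d v)) = 0" for p
    using w(2) act_in_cyclic_submodule B_zero_sym by blast
  have orth_vdw: "B v (act p (d w)) = 0" for p
    using w(2) act_in_cyclic_submodule[of p "d v"] act_d_skewadjoint[of p v w] by auto
  let ?Lp = "sum_set (cyclic_submodule v) (cyclic_submodule (d w))" and ?Lm = "sum_set (cyclic_submodule w) (cyclic_submodule (d v))"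
  have "lagrangian_pair U ?Lp ?Lm"
  proof (rule lagrangian_pairI[where v = v])
    show "v \<noteq> 0" using v by auto
    show vL: "v \<in> ?Lp" by (intro sum_set_upper1 subspace_cyclic_submodule self_in_cyclic_submodule)
    show "isotropic ?Lp"
      using cyclic_submodule_orthogonal[of v "d w"] orth_vdw by (intro isotropic_sum_set isotropic_cyclic_submodule) blast
    show "isotropic ?Lm"
      using cyclic_submodule_orthogonal[of w "d v"] orth_wdv by (intro isotropic_sum_set isotropic_cyclic_submodule) blast
    show "c ` ?Lp \<subseteq> ?Lp" "c ` ?Lm \<subseteq> ?Lm"
      by (intro image_sum_set_subset c_linear c_cyclic_submodule)+
    show "d ` ?Lp \<subseteq> ?Lm" "d ` ?Lm \<subseteq> ?Lp"
      by (subst (2) sum_set_commute, intro image_sum_set_subset d_linear d_cyclic_submodule d_cyclic_submodule_d)+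
    have "cyclic_submodule v \<subseteq> U" "cyclic_submodule w \<subseteq> U" "cyclic_submodule (d v) \<subseteq> U" "cyclic_submodule (d w) \<subseteq> U"
      using v w d_U by (simp_all add: cyclic_submodule_subset[OF stable_U])
    then show "?Lp \<subseteq> U" "?Lm \<subseteq> U"
      using subspace_U by (auto simp: sum_set_def intro!: subspace_add)
    fix R x
    assume R: "stable R" "R \<subseteq> U" and orth: "\<And>r y. r \<in> R \<Longrightarrow> y \<in> ?Lp \<union> ?Lm \<Longrightarrow> B r y = 0"
      and x: "x \<in> R" "x \<in> ?Lp \<union> ?Lm"
    have "w \<in> ?Lm" by (intro sum_set_upper1 subspace_cyclic_submodule self_in_cyclic_submodule)
    then have nR: "act (f ^ k) v \<notin> R" "act (f ^ k) w \<notin> R"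
      using orth vL w(3) w' by blast+
    from x(2) consider a b where "x = act a v + act b (d w)" | a b where "x = act a w + act b (d v)"
      unfolding sum_set_def cyclic_submodule_def by blast
    then show "x = 0"
      using radical_in_bicyclic_case[OF dd fd R] v(1) w(1) nR x(1) by cases auto
  qed (intro subspace_sum_set subspace_cyclic_submodule)+
  then show ?thesis by blast
qed

text \<open>The form \<open>B (f\<^sup>k(c) x) (d y)\<close> is symmetric. If it is not zero, some \<open>v\<close> is anisotropic for it, as the
  characteristic is not 2, and \<open>U\<close> is cyclic. If it is zero, then \<open>f\<close> divides \<open>t\<^sup>2 - 4\<close>, which is squarefree,
  and the bicyclic case applies.\<close>

lemma ex_lagrangian_pair_block: "\<exists>Lp Lm. lagrangian_pair U Lp Lm"
proof (cases "\<exists>v\<in>U. B (act (f ^ k) v) (d v) \<noteq> 0")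
  case True
  then show ?thesis using cyclic_case by blast
next
  case False
  have fd: "act (f ^ k) (d y) = 0" if y: "y \<in> U" for y
  proof -
    have "B (act (f ^ k) (d y)) x = 0" if x: "x \<in> U" for x
    proof -
      have "B (act (f ^ k) (x + y)) (d (x + y)) = 0" "B (act (f ^ k) x) (d x) = 0"
        "B (act (f ^ k) y) (d y) = 0" using False x y subspace_U subspace_add by blast+
      then have "B (act (f ^ k) x) (d y) = - B (act (f ^ k) y) (d x)"
        by (simp add: act_add_right d.add B_simps eq_neg_iff_add_eq_0 add.commute)
      also have "B (act (f ^ k) y) (d x) = B (act (f ^ k) x) (d y)"
        using act_d_skewadjoint[of "f ^ k" x y] B_skew[of "act (f ^ k) (d x)" y]
        by (simp add: act_selfadjoint)
      finally have "B (act (f ^ k) x) (d y) = 0" by (rule eq_minus_self_imp_zero[OF two])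
      then show ?thesis using B_zero_sym by (simp add: act_selfadjoint)
    qed
    then show ?thesis using nondegenerate_U act_U[OF d_U[OF y]] unfolding nondegenerate_on_def by blast
  qed
  obtain v where v: "v \<in> U" "act (f ^ k) v \<noteq> 0" using socle_nonzero by blast
  have "act [:-4, 0, 1:] (act (f ^ k) v) = 0"
    unfolding d_d_act[symmetric] act_d[symmetric] fd[OF v(1)] by (rule d.zero)
  then have "f dvd [:-4, 0, 1:]" using injective v act_U by blast
  then obtain h where h: "[:-4, 0, 1:] = f * h" by blast
  have "\<not> f dvd h"
  proof
    assume "f dvd h"
    then obtain e where e: "h = f * e" by blast
    \<comment> \<open>A double factor of \<open>t\<^sup>2 - 4\<close> divides the derivative \<open>2t\<close> too, hence \<open>t * 2t - 2(t\<^sup>2 - 4) = 8\<close>.\<close>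
    have "pderiv [:-4, 0, 1:] = f * pderiv (f * e) + f * e * pderiv f"
      unfolding h e by (rule pderiv_mult)
    then have "f dvd pderiv [:-4, 0, 1:]" by (simp only: dvd_add dvd_triv_left mult.assoc)
    then have "f dvd [:0, 1:] * pderiv [:-4, 0, 1:] - [:2:] * [:-4, 0, 1:]"
      using h by (intro dvd_diff dvd_mult) auto
    also have "[:0, 1:] * pderiv [:-4, 0, 1:] - [:2:] * [:-4, 0, 1:] = [:2 ^ 3 :: 'a:]"
      by (simp add: pderiv_pCons)
    finally obtain r where r: "[:2 ^ 3 :: 'a:] = r * f" by (metis dvd_def mult.commute)
    obtain x where x: "x \<in> U" "x \<noteq> 0" "act f x = 0" using ex_killed by blast
    have "scl (2 ^ 3) x = act [:2 ^ 3:] x" by (simp add: c.zero)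
    also have "\<dots> = 0" unfolding r using x by (simp add: act_mult)
    finally show False using x power_not_zero[OF two, of 3] by (simp only: scale_eq_0_iff) simp
  qed
  then show ?thesis using bicyclic_case[OF h] fd by blast
qed

end

context adjoint_pair
begin

text \<open>The polynomial \<open>f\<close> is one of least degree among those that act noninjectively. Suppose that \<open>p\<close> acts
  noninjectively, hence nilpotently. On the kernel of \<open>f(c)\<close> it agrees with \<open>p mod f\<close>, which is injective
  if it is nonzero; thus \<open>f\<close> divides \<open>p\<close>.\<close>

lemma ex_primary_block:
  assumes U: "regular U" "U \<noteq> {0}"
    and min: "\<And>R. regular R \<Longrightarrow> R \<subseteq> U \<Longrightarrow> R = {0} \<or> R = U"
  shows "\<exists>f k. primary_block scl B n c d U f k"
proof -
  have sU: "subspace U" using U by (auto simp: regular_def stable_def)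
  then obtain v where v: "v \<in> U" "v \<noteq> 0" using U(2) subspace_0 by blast
  define bad where "bad p \<longleftrightarrow> p \<noteq> 0 \<and> (\<exists>x\<in>U. x \<noteq> 0 \<and> act p x = 0)" for p
  have "\<exists>p. bad p" using ex_annihilating_poly[of v] v by (auto simp: bad_def)
  then obtain f where f: "bad f" "\<And>p. bad p \<Longrightarrow> degree f \<le> degree p"
    using ex_has_least_nat[of bad _ degree] by blast
  then obtain x0 where x0: "x0 \<in> U" "x0 \<noteq> 0" "act f x0 = 0" and f0: "f \<noteq> 0"
    by (auto simp: bad_def)
  have actU: "act p x \<in> U" if "x \<in> U" for p x
    using U that by (auto simp: regular_def stable_def intro: act_mem)
  have inj: "x = 0" if p: "\<not> f dvd p" and x: "x \<in> U" "act p x = 0" for p x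
  proof (rule ccontr)
    assume "x \<noteq> 0"
    then have "\<not> (\<forall>x\<in>U. act p x = 0 \<longrightarrow> x = 0)" using x by blast
    then obtain m where m: "\<forall>x\<in>U. act (p ^ m) x = 0"
      using selfadjoint_nilpotent_or_injective[OF U(1) min] by blast
    let ?r = "p mod f"
    have r: "?r \<noteq> 0" "degree ?r < degree f"
      using p f0 degree_mod_less'[of f p] by (auto simp: dvd_eq_mod_eq_0)
    have rinj: "y = 0" if "y \<in> U" "act ?r y = 0" for y
      using f(2)[of ?r] r that by (auto simp: bad_def)
    have "act (p ^ i) x0 \<noteq> 0" for i
    proof (induction i)
      case 0
      then show ?case using x0 by simp
    next
      case (Suc i)
      let ?y = "act (p ^ i) x0"
      have "act f ?y = 0" using x0(3) act_commute[of f "p ^ i" x0] by simp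
      then have "act p ?y = act ?r ?y"
        using act_add[of "p div f * f" ?r ?y] by (simp add: act_mult)
      then show ?case using rinj[of ?y] Suc actU x0(1) by (auto simp: act_mult)
    qed
    then show False using m x0(1) by blast
  qed
  obtain m where "\<forall>x\<in>U. act (f ^ m) x = 0"
    using selfadjoint_nilpotent_or_injective[OF U(1) min] x0 by blast
  then have ex: "\<exists>m. \<forall>x\<in>U. act (f ^ m) x = 0" by blast
  define m where "m = (LEAST m. \<forall>x\<in>U. act (f ^ m) x = 0)"
  have m: "\<forall>x\<in>U. act (f ^ m) x = 0" unfolding m_def using LeastI_ex[OF ex] .
  have "m \<noteq> 0"
  proof
    assume "m = 0"
    then show False using m v by simp
  qed
  then obtain k where k: "m = Suc k" using not0_implies_Suc by blast
  then have "\<exists>x\<in>U. act (f ^ k) x \<noteq> 0"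
    using not_less_Least[of k "\<lambda>m. \<forall>x\<in>U. act (f ^ m) x = 0"] unfolding m_def by auto
  then have "primary_block scl B n c d U f k"
    using U(1) min inj m unfolding k by unfold_locales auto
  then show ?thesis by blast
qed

lemma ex_lagrangian_pair: "regular U \<Longrightarrow> \<exists>Lp Lm. lagrangian_pair U Lp Lm"
proof (induction "dim U" arbitrary: U rule: less_induct)
  case less
  have sU: "subspace U" using less.prems by (auto simp: regular_def stable_def)
  consider "U = {0}" | "U \<noteq> {0}" "\<And>R. regular R \<Longrightarrow> R \<subseteq> U \<Longrightarrow> R = {0} \<or> R = U"
    | R where "regular R" "R \<subseteq> U" "R \<noteq> {0}" "R \<noteq> U" by blast
  then show ?case
  proof cases
    case 1
    then have "lagrangian_pair U {0} {0}"
      by (auto simp: lagrangian_pair_def isotropic_def sum_set_def B_simps c.zero d.zero)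
    then show ?thesis by blast
  next
    case 2
    then obtain f k where "primary_block scl B n c d U f k"
      using ex_primary_block[OF less.prems] by metis
    then show ?thesis by (rule primary_block.ex_lagrangian_pair_block)
  next
    case (3 R)
    define Q where "Q = {x \<in> U. \<forall>y\<in>R. B x y = 0}"
    have Q: "regular Q" "U = sum_set R Q"
      using orthogonal_splitting[OF less.prems 3(1,2)] by (auto simp: Q_def)
    have sR: "subspace R" and sQ: "subspace Q" using 3 Q by (auto simp: regular_def stable_def)
    have "dim R < dim U" using 3 sR sU by (intro psubspace_dim_less) auto
    moreover have "Q \<noteq> U"
    proof
      assume "Q = U"
      then have "\<forall>x\<in>R. \<forall>y\<in>R. B x y = 0" using 3(2) by (auto simp: Q_def)
      then have "R \<subseteq> {0}" using 3(1) by (auto simp: regular_def nondegenerate_on_def)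
      then show False using 3(3) sR subspace_0 by blast
    qed
    then have "dim Q < dim U" using sQ sU by (intro psubspace_dim_less) (auto simp: Q_def)
    ultimately obtain Lp Lm Mp Mm where "lagrangian_pair R Lp Lm" "lagrangian_pair Q Mp Mm"
      using less.hyps 3(1) Q(1) by blast
    then have "lagrangian_pair (sum_set R Q) (sum_set Lp Mp) (sum_set Lm Mm)"
      by (rule lagrangian_pair_sum) (auto simp: Q_def intro: B_zero_sym)
    then show ?thesis unfolding Q(2)[symmetric] by blast
  qed
qed

end

section \<open>Antisymplectic involutions inverting a symplectic map\<close>

context symplectic_space
begin

definition antisymplectic_involution :: "('w \<Rightarrow> 'w) \<Rightarrow> bool" where
  "antisymplectic_involution s \<longleftrightarrow>
    Vector_Spaces.linear scl scl s \<and> (\<forall>x. s (s x) = x) \<and> has_similitude B s (-1)"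

definition lagrangian :: "'w set \<Rightarrow> bool" where
  "lagrangian L \<longleftrightarrow> subspace L \<and> isotropic L \<and> (\<forall>x. (\<forall>y\<in>L. B x y = 0) \<longrightarrow> x \<in> L)"

lemma subspace_UNIV: "subspace UNIV" by (simp add: subspace_def)

lemma nondegenerate_UNIV: "nondegenerate_on UNIV"
  using nondegenerate by (auto simp: nondegenerate_on_def)

lemma isotropic_complements_disjoint:
  assumes "isotropic L" "isotropic M" "sum_set L M = UNIV" "x \<in> L" "x \<in> M"
  shows "x = 0"
proof (rule nondegenerate)
  show "\<forall>u. B x u = 0"
  proof
    fix u
    have "u \<in> sum_set L M" using assms by simp
    then obtain y z where "y \<in> L" "z \<in> M" "u = y + z" by (auto simp: sum_set_def)
    then show "B x u = 0" using assms by (simp add: isotropic_def B_simps)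
  qed
qed

lemma lagrangian_if_complement:
  assumes L: "subspace L" "isotropic L" and M: "isotropic M" and LM: "sum_set L M = UNIV"
  shows "lagrangian L"
  unfolding lagrangian_def
proof (intro conjI allI impI L)
  fix x assume x: "\<forall>y\<in>L. B x y = 0"
  have "x \<in> sum_set L M" using LM by simp
  then obtain a b where ab: "a \<in> L" "b \<in> M" "x = a + b" by (auto simp: sum_set_def)
  have "b = 0"
  proof (rule nondegenerate, rule allI)
    fix u
    have "u \<in> sum_set L M" using LM by simp
    then obtain y z where "y \<in> L" "z \<in> M" "u = y + z" by (auto simp: sum_set_def)
    moreover from this have "B (a + b) y = 0" "B a y = 0" using x ab L by (auto simp: isotropic_def)
    ultimately show "B b u = 0" using M ab by (simp add: isotropic_def B_simps)
  qed
  then show "x \<in> L" using ab by simp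
qed

lemma involution_of_pair:
  assumes two: "(2::'a) \<noteq> 0"
    and L: "subspace Lp" "subspace Lm" "isotropic Lp" "isotropic Lm" "sum_set Lp Lm = UNIV"
  shows "\<exists>s. antisymplectic_involution s \<and> (\<forall>x. s x = x \<longleftrightarrow> x \<in> Lp) \<and> (\<forall>x. s x = - x \<longleftrightarrow> x \<in> Lm)"
proof -
  have "\<exists>y z. y \<in> Lp \<and> z \<in> Lm \<and> u = y + z" for u
  proof -
    have "u \<in> sum_set Lp Lm" using L by simp
    then show ?thesis by (auto simp: sum_set_def)
  qed
  then obtain P M where PM: "\<And>u. P u \<in> Lp" "\<And>u. M u \<in> Lm" "\<And>u. u = P u + M u" by metis
  have uniq: "P (y + z) = y \<and> M (y + z) = z" if "y \<in> Lp" "z \<in> Lm" for y z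
  proof -
    have e: "P (y + z) - y = z - M (y + z)"
      using PM(3)[of "y + z"] by (simp add: algebra_simps)
    have "P (y + z) - y \<in> Lp" using PM(1) that L by (intro subspace_diff) auto
    moreover have "P (y + z) - y \<in> Lm" unfolding e using PM(2) that L by (intro subspace_diff) auto
    ultimately have "P (y + z) - y = 0" using isotropic_complements_disjoint L by blast
    then show ?thesis using e by simp
  qed
  define s where "s u = P u - M u" for u
  have s: "s (y + z) = y - z" if "y \<in> Lp" "z \<in> Lm" for y z
    using uniq[OF that] by (simp add: s_def)
  have double: "x = 0" if "x + x = 0" for x :: 'w
  proof -
    have "scl 2 x = 0" using that scale_left_distrib[of 1 1 x] by simp
    then show ?thesis using two by simp
  qed
  have "Vector_Spaces.linear scl scl s"
  proof unfold_locales
    fix u v a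
    have "s ((P u + P v) + (M u + M v)) = (P u + P v) - (M u + M v)"
      using PM L by (intro s subspace_add) auto
    moreover have "(P u + P v) + (M u + M v) = (P u + M u) + (P v + M v)" by (simp add: add_ac)
    ultimately have "s ((P u + M u) + (P v + M v)) = (P u + P v) - (M u + M v)" by simp
    then show "s (u + v) = s u + s v"
      unfolding PM(3)[symmetric] by (simp add: s_def algebra_simps)
    have "s (scl a (P u) + scl a (M u)) = scl a (P u) - scl a (M u)"
      using PM L by (intro s subspace_scale) auto
    then show "s (scl a u) = scl a (s u)"
      using PM(3)[of u] by (simp add: s_def scale_right_diff_distrib flip: scale_right_distrib)
  qed
  moreover have "s (s u) = u" for u
    using s[of "P u" "- M u"] PM L by (simp add: s_def[of u] subspace_neg flip: PM(3))
  moreover have "has_similitude B s (-1)"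
    unfolding has_similitude_def
  proof (intro allI)
    fix u v
    have "B (P u + M u) (P v + M v) = B (P u) (M v) + B (M u) (P v)"
      "B (P u - M u) (P v - M v) = - B (P u) (M v) - B (M u) (P v)"
      using PM(1,2) L(3,4) by (auto simp: isotropic_def B_simps)
    then show "B (s u) (s v) = - 1 * B u v" using PM(3) by (simp add: s_def)
  qed
  moreover have "s u = u \<longleftrightarrow> u \<in> Lp" for u
  proof
    assume "s u = u"
    then have "M u + M u = 0" using PM(3)[of u] by (simp add: s_def algebra_simps)
    then have "M u = 0" by (rule double)
    then show "u \<in> Lp" using PM(1,3)[of u] by simp
  next
    assume "u \<in> Lp"
    then show "s u = u" using s[of u 0] subspace_0[OF L(2)] by simp
  qed
  moreover have "s u = - u \<longleftrightarrow> u \<in> Lm" for u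
  proof
    assume "s u = - u"
    then have "s u + (P u + M u) = 0" unfolding PM(3)[symmetric] by simp
    then have "P u + P u = 0" by (simp add: s_def)
    then have "P u = 0" by (rule double)
    then show "u \<in> Lm" using PM(2,3)[of u] by simp
  next
    assume "u \<in> Lm"
    then show "s u = - u" using s[of 0 u] subspace_0[OF L(1)] by simp
  qed
  ultimately show ?thesis unfolding antisymplectic_involution_def by blast
qed

lemma isometry_in_Sp:
  assumes k: "Vector_Spaces.linear scl scl k" and iso: "\<And>x y. B (k x) (k y) = B x y"
  shows "k \<in> carrier (Sp scl B)"
proof -
  interpret k: Vector_Spaces.linear scl scl k by fact
  have ker: "x = 0" if "k x = 0" for x
    using iso[of x] that by (intro nondegenerate) (simp add: B_simps)
  then have "inj k"
    by (intro injI) (metis k.diff right_minus_eq)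
  moreover have "surj k"
    using linear_on_subspace_inj_imp_surj[OF k subspace_UNIV] ker by simp
  ultimately show ?thesis
    using k iso by (auto simp: Sp_def GSp_def has_similitude_def bij_def intro!: exI[of _ 1])
qed

lemma SpD:
  assumes "g \<in> carrier (Sp scl B)"
  shows "Vector_Spaces.linear scl scl g" "bij g" "B (g x) (g y) = B x y"
  using assms by (auto simp: Sp_def GSp_def has_similitude_def)

text \<open>The involution \<open>s\<close> with the eigenspaces of a Lagrangian pair for \<open>c = g + g\<^sup>-\<^sup>1\<close> and \<open>d = g - g\<^sup>-\<^sup>1\<close>
  commutes with \<open>c\<close> and anticommutes with \<open>d\<close>; since \<open>2g = c + d\<close> and \<open>2g\<^sup>-\<^sup>1 = c - d\<close>, it conjugates \<open>g\<close>
  to \<open>g\<^sup>-\<^sup>1\<close>.\<close>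

lemma inverted_by_antisymplectic_involution:
  assumes two: "(2::'a) \<noteq> 0" and g: "g \<in> carrier (Sp scl B)"
  shows "\<exists>s. antisymplectic_involution s \<and> (\<forall>x. s (g (s (g x))) = x)"
proof -
  interpret g: Vector_Spaces.linear scl scl g by (rule SpD(1)[OF g])
  define k where "k = inv_into UNIV g"
  have gk: "g (k x) = x" and kg: "k (g x) = x" for x
    using SpD(2)[OF g] by (simp_all add: k_def bij_is_surj bij_is_inj surj_f_inv_f)
  have klin: "Vector_Spaces.linear scl scl k"
  proof unfold_locales
    fix x y a
    have "k (x + y) = k (g (k x + k y))" by (simp add: g.add gk)
    then show "k (x + y) = k x + k y" by (simp add: kg)
    have "k (scl a x) = k (g (scl a (k x)))" by (simp add: g.scale gk)
    then show "k (scl a x) = scl a (k x)" by (simp add: kg)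
  qed
  interpret k: Vector_Spaces.linear scl scl k by (rule klin)
  have adj: "B (g x) y = B x (k y)" for x y
    using SpD(3)[OF g, of x "k y"] by (simp add: gk)
  have adj': "B (k x) y = B x (g y)" for x y
    using SpD(3)[OF g, of "k x" y] by (simp add: gk)
  define c where "c x = g x + k x" for x
  define d where "d x = g x - k x" for x
  have four: "scl 4 x = x + x + x + x" for x
  proof -
    have "scl (1 + 1 + 1 + 1) x = x + x + x + x" by (simp only: scale_left_distrib scale_one)
    then show ?thesis by simp
  qed
  interpret adjoint_pair scl B n c d
  proof unfold_locales
    show "(2::'a) \<noteq> 0" by (rule two)
  qed (auto simp: c_def d_def g.add k.add g.scale k.scale g.diff k.diff scale_right_distrib
      scale_right_diff_distrib B_simps adj adj' gk kg four algebra_simps)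
  have "regular UNIV"
    using nondegenerate_UNIV subspace_UNIV by (simp add: regular_def stable_def)
  then obtain Lp Lm where L: "lagrangian_pair UNIV Lp Lm" using ex_lagrangian_pair by blast
  then obtain s where s: "antisymplectic_involution s"
      "\<And>x. s x = x \<longleftrightarrow> x \<in> Lp" "\<And>x. s x = - x \<longleftrightarrow> x \<in> Lm"
    using involution_of_pair[OF two, of Lp Lm] by (auto simp: lagrangian_pair_def)
  interpret s: Vector_Spaces.linear scl scl s
    using s(1) by (simp add: antisymplectic_involution_def)
  have sg: "s (g u) = k (s u)" for u
  proof -
    have "u \<in> sum_set Lp Lm" using L by (simp add: lagrangian_pair_def)
    then obtain y z where yz: "y \<in> Lp" "z \<in> Lm" "u = y + z" by (auto simp: sum_set_def)
    have "s y = y" "s z = - z" "s (c y) = c y" "s (d y) = - d y" "s (c z) = - c z" "s (d z) = d z"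
      using yz L unfolding s lagrangian_pair_def by blast+
    then have "s (c u + d u) = c (s u) - d (s u)"
      by (simp add: yz(3) s.add c.add d.add c.neg d.neg c.diff d.diff algebra_simps)
    moreover have "c u + d u = scl 2 (g u)" "c (s u) - d (s u) = scl 2 (k (s u))"
      using scale_left_distrib[of 1 1] by (simp_all add: c_def d_def)
    ultimately have "scl 2 (s (g u)) = scl 2 (k (s u))" by (simp add: s.scale)
    then show ?thesis using two by simp
  qed
  have "s (g (s (g x))) = x" for x
    using s(1) unfolding sg[of "s (g x)"] by (simp add: kg antisymplectic_involution_def)
  then show ?thesis using s(1) by blast
qed

section \<open>Conjugacy of antisymplectic involutions\<close>

lemma isotropic_span_extension:
  assumes N: "subspace N" "isotropic N" and x: "\<forall>y\<in>N. B x y = 0"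
  shows "isotropic (sum_set N (range (\<lambda>a. scl a x)))"
proof (rule isotropic_sum_set[OF N(2)])
  show "isotropic (range (\<lambda>a. scl a x))"
    by (auto simp: isotropic_def B_simps alternating)
  show "B y z = 0" if "y \<in> N" "z \<in> range (\<lambda>a. scl a x)" for y z
    using that x by (auto simp: B_simps intro: B_zero_sym)
qed

text \<open>Suppose that \<open>L + N\<close> is not the whole space. Then neither \<open>L + N\<close> nor \<open>M + N\<close> contains the orthogonal
  complement of \<open>N\<close>. A vector space is not the union of two proper subspaces, so some \<open>x\<close> orthogonal to \<open>N\<close> lies
  outside both sums, and \<open>N\<close> can be enlarged by \<open>x\<close>.\<close>

lemma maximal_isotropic_is_complement:
  assumes L: "lagrangian L" and M: "lagrangian M" and N: "subspace N" "isotropic N"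
    and NL: "N \<inter> L = {0}" and NM: "N \<inter> M = {0}"
    and max: "\<And>N'. subspace N' \<Longrightarrow> isotropic N' \<Longrightarrow> N' \<inter> L = {0} \<Longrightarrow> N' \<inter> M = {0} \<Longrightarrow> dim N' \<le> dim N"
  shows "sum_set L N = UNIV"
proof (rule ccontr)
  assume LN: "sum_set L N \<noteq> UNIV"
  have escape: "\<exists>x. (\<forall>y\<in>N. B x y = 0) \<and> x \<notin> sum_set K N"
    if K: "lagrangian K" "N \<inter> K = {0}" "sum_set K N \<noteq> UNIV" for K
  proof (rule ccontr)
    assume *: "\<not> ?thesis"
    have sK: "subspace K" using K by (simp add: lagrangian_def)
    obtain y where y: "y \<notin> sum_set K N" using K by blast
    then obtain w where w: "\<forall>z\<in>sum_set K N. B z w = 0" "B y w \<noteq> 0"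
      using separate_from_subspace[OF nondegenerate_UNIV subspace_UNIV subspace_sum_set[OF sK N(1)]]
      by auto
    have "B w z = 0" if "z \<in> K" for z
      using w(1)[rule_format, OF sum_set_upper1[OF N(1) that]] by (rule B_zero_sym)
    then have "w \<in> K" using K by (simp add: lagrangian_def)
    moreover have "w \<in> N"
    proof (rule ccontr)
      assume "w \<notin> N"
      then obtain u where u: "\<forall>z\<in>N. B z u = 0" "B w u \<noteq> 0"
        using separate_from_subspace[OF nondegenerate_UNIV subspace_UNIV N(1)] by auto
      then have "u \<in> sum_set K N" using * B_zero_sym by blast
      then show False using w(1) u(2) B_zero_sym by blast
    qed
    ultimately have "w = 0" using K(2) by blast
    then show False using w(2) by (simp add: B_simps)
  qed
  obtain x1 where x1: "\<forall>y\<in>N. B x1 y = 0" "x1 \<notin> sum_set L N" using escape[OF L NL LN] by blast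
  have sL: "subspace L" and sM: "subspace M" using L M by (auto simp: lagrangian_def)
  have "sum_set M N \<noteq> UNIV"
  proof
    assume MN: "sum_set M N = UNIV"
    then have "lagrangian N"
      using lagrangian_if_complement[of N M] N M by (simp add: lagrangian_def sum_set_commute)
    then have "x1 \<in> N" using x1 by (simp add: lagrangian_def)
    then show False using x1(2) sum_set_upper2[OF sL] by blast
  qed
  then obtain x2 where x2: "\<forall>y\<in>N. B x2 y = 0" "x2 \<notin> sum_set M N" using escape[OF M NM] by blast
  have "\<exists>x. (\<forall>y\<in>N. B x y = 0) \<and> x \<notin> sum_set L N \<and> x \<notin> sum_set M N"
  proof (cases "x1 \<in> sum_set M N \<and> x2 \<in> sum_set L N")
    case True
    have "x1 + x2 \<notin> sum_set L N"
    proof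
      assume "x1 + x2 \<in> sum_set L N"
      then have "(x1 + x2) - x2 \<in> sum_set L N"
        using True sL N by (intro subspace_diff subspace_sum_set) auto
      then show False using x1 by simp
    qed
    moreover have "x1 + x2 \<notin> sum_set M N"
    proof
      assume "x1 + x2 \<in> sum_set M N"
      then have "(x1 + x2) - x1 \<in> sum_set M N"
        using True sM N by (intro subspace_diff subspace_sum_set) auto
      then show False using x2 by simp
    qed
    ultimately show ?thesis using x1 x2 by (intro exI[of _ "x1 + x2"]) (simp add: B_simps)
  next
    case False
    then show ?thesis using x1 x2 by blast
  qed
  then obtain x where x: "\<forall>y\<in>N. B x y = 0" "x \<notin> sum_set L N" "x \<notin> sum_set M N" by blast
  define N' where "N' = sum_set N (range (\<lambda>a. scl a x))"
  have sx: "subspace (range (\<lambda>a. scl a x))"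
    using subspace_span[of "{x}"] by (simp only: span_singleton)
  have sN': "subspace N'" unfolding N'_def using N(1) sx by (rule subspace_sum_set)
  have disj: "N' \<inter> K = {0}" if K: "subspace K" "N \<inter> K = {0}" "x \<notin> sum_set K N" for K
  proof -
    have "u = 0" if u: "u \<in> N'" "u \<in> K" for u
    proof -
      obtain m a where m: "m \<in> N" "u = m + scl a x" using u(1) by (auto simp: N'_def sum_set_def)
      have "a = 0"
      proof (rule ccontr)
        assume a: "a \<noteq> 0"
        have "scl (1 / a) (u - m) = x" using a m(2) by simp
        moreover have "u - m \<in> sum_set K N"
          using sum_set_memI[of u K "- m" N] u(2) m(1) N(1) by (simp add: subspace_neg)
        ultimately have "x \<in> sum_set K N"
          using subspace_scale[OF subspace_sum_set[OF K(1) N(1)]] by metis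
        then show False using K(3) by blast
      qed
      then show "u = 0" using m u K by auto
    qed
    then show ?thesis using subspace_0[OF sN'] subspace_0[OF K(1)] by blast
  qed
  have "dim N' \<le> dim N"
    using isotropic_span_extension[OF N x(1)] disj[OF sL NL x(2)] disj[OF sM NM x(3)] sN'
    by (intro max) (simp_all add: N'_def)
  moreover have "N \<subset> N'"
  proof -
    have "N \<subseteq> N'" using sum_set_upper1[OF sx] by (auto simp: N'_def)
    moreover have "scl 1 x \<in> N'" unfolding N'_def by (intro sum_set_upper2 N(1) rangeI)
    moreover have "x \<notin> N" using x(2) sum_set_upper2[OF sL] by blast
    ultimately show ?thesis by auto
  qed
  ultimately show False using psubspace_dim_less[OF N(1) sN'] by simp
qed

lemma common_lagrangian_complement:
  assumes L: "lagrangian L" and M: "lagrangian M"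
  shows "\<exists>N. subspace N \<and> isotropic N \<and> sum_set L N = UNIV \<and> sum_set M N = UNIV"
proof -
  define good where "good N \<longleftrightarrow> subspace N \<and> isotropic N \<and> N \<inter> L = {0} \<and> N \<inter> M = {0}" for N
  have "subspace L" "subspace M" using L M unfolding lagrangian_def by blast+
  then have "good {0}"
    using subspace_0[of L] subspace_0[of M] by (simp add: good_def isotropic_def B_simps)
  moreover have "\<forall>N. good N \<longrightarrow> dim N < Suc (dim UNIV)"
  proof (intro allI impI)
    fix N assume "good N"
    then show "dim N < Suc (dim UNIV)"
      using psubspace_dim_less[of N UNIV] subspace_UNIV
      by (cases "N = UNIV") (auto simp: good_def psubset_eq)
  qed
  ultimately obtain N where N: "good N" "\<And>N'. good N' \<Longrightarrow> dim N' \<le> dim N"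
    using ex_has_greatest_nat[of good "{0}" dim] by blast
  then have "sum_set L N = UNIV" "sum_set M N = UNIV"
    using maximal_isotropic_is_complement[OF L M, of N] maximal_isotropic_is_complement[OF M L, of N]
    by (auto simp: good_def)
  then show ?thesis using N by (auto simp: good_def)
qed

definition Sp_conjugate :: "('w \<Rightarrow> 'w) \<Rightarrow> ('w \<Rightarrow> 'w) \<Rightarrow> bool" where
  "Sp_conjugate s t \<longleftrightarrow> (\<exists>k\<in>carrier (Sp scl B). \<forall>x. k (s x) = t (k x))"

lemma Sp_conjugate_trans: "Sp_conjugate r s \<Longrightarrow> Sp_conjugate s t \<Longrightarrow> Sp_conjugate r t"
proof -
  assume "Sp_conjugate r s" "Sp_conjugate s t"
  then obtain k l where k: "k \<in> carrier (Sp scl B)" "\<forall>x. k (r x) = s (k x)"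
    and l: "l \<in> carrier (Sp scl B)" "\<forall>x. l (s x) = t (l x)"
    by (auto simp: Sp_conjugate_def)
  interpret G: group "Sp scl B" by (rule group_Sp)
  have "l \<circ> k \<in> carrier (Sp scl B)"
    using G.m_closed[OF l(1) k(1)] by (simp add: Sp_def GSp_def)
  then show ?thesis using k l unfolding Sp_conjugate_def by (intro bexI[of _ "l \<circ> k"]) auto
qed

text \<open>The hypothesis says that \<open>u = ts\<close> satisfies \<open>u + u\<^sup>-\<^sup>1 = 2\<close>, so \<open>u\<close> is unipotent with \<open>(u - 1)\<^sup>2 = 0\<close>.
  The conjugating element is its square root \<open>(1 + u) / 2\<close>.\<close>

lemma Sp_conjugate_if_anticommutator:
  assumes two: "(2::'a) \<noteq> 0" and s: "antisymplectic_involution s" and t: "antisymplectic_involution t"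
    and st: "\<And>x. s (t x) + t (s x) = x + x"
  shows "Sp_conjugate s t"
proof -
  interpret s: Vector_Spaces.linear scl scl s using s by (simp add: antisymplectic_involution_def)
  interpret t: Vector_Spaces.linear scl scl t using t by (simp add: antisymplectic_involution_def)
  have ss: "s (s x) = x" and tt: "t (t x) = x" for x
    using s t by (simp_all add: antisymplectic_involution_def)
  have Bs: "B (s x) y = - B x (s y)" and Bt: "B (t x) y = - B x (t y)" for x y
    using s t ss[of y] tt[of y] unfolding antisymplectic_involution_def has_similitude_def
    by (metis mult_minus1)+
  define k where "k x = scl (1/2) (x + t (s x))" for x
  have "Vector_Spaces.linear scl scl k"
    by unfold_locales
      (auto simp: k_def s.add t.add s.scale t.scale scale_right_distrib mult.commute algebra_simps)
  moreover have "B (k x) (k y) = B x y" for x y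
  proof -
    have "B (k x) (k y) = (1/2) * (1/2) *
        (B x y + B x (t (s y)) + B (t (s x)) y + B (t (s x)) (t (s y)))"
      by (simp add: k_def B_simps algebra_simps)
    also have "B (t (s x)) (t (s y)) = B x y" by (simp add: Bs Bt ss tt)
    also have "B (t (s x)) y = B x (s (t y))" by (simp add: Bs Bt)
    also have "B x y + B x (t (s y)) + B x (s (t y)) + B x y = B x y + B x (s (t y) + t (s y)) + B x y"
      by (simp add: B_simps)
    also have "\<dots> = 2 * 2 * B x y" by (simp add: st B_simps)
    finally show ?thesis using two mult_eq_0_iff[of "2::'a" 2] by simp
  qed
  ultimately have "k \<in> carrier (Sp scl B)" by (rule isometry_in_Sp)
  moreover have "k (s x) = t (k x)" for x
    by (simp add: k_def ss tt t.add t.scale add.commute)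
  ultimately show ?thesis by (auto simp: Sp_conjugate_def)
qed

text \<open>Each of \<open>s\<close> and \<open>t\<close> fixes the vectors \<open>x + s x\<close> and \<open>x + t x\<close>. Adding \<open>t (x + s x) = x + s x\<close> and
  \<open>s (x + t x) = x + t x\<close> gives the anticommutator relation.\<close>

lemma Sp_conjugate_if_same_fixed_space:
  assumes two: "(2::'a) \<noteq> 0" and s: "antisymplectic_involution s" and t: "antisymplectic_involution t"
    and fixed: "\<And>x. s x = x \<longleftrightarrow> t x = x"
  shows "Sp_conjugate s t"
proof (rule Sp_conjugate_if_anticommutator[OF two s t])
  interpret s: Vector_Spaces.linear scl scl s using s by (simp add: antisymplectic_involution_def)
  interpret t: Vector_Spaces.linear scl scl t using t by (simp add: antisymplectic_involution_def)
  fix x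
  have "s (x + s x) = x + s x" "t (x + t x) = x + t x"
    using s t by (simp_all add: antisymplectic_involution_def s.add t.add add.commute)
  then have "t (x + s x) = x + s x" "s (x + t x) = x + t x" using fixed by blast+
  then have "t x + t (s x) = x + s x" "s x + s (t x) = x + t x" by (simp_all add: s.add t.add)
  then have "(t x + t (s x)) + (s x + s (t x)) = (x + s x) + (x + t x)" by (simp only:)
  then show "s (t x) + t (s x) = x + x" by (simp add: algebra_simps)
qed

lemma antisymplectic_involution_minus:
  assumes s: "antisymplectic_involution s" shows "antisymplectic_involution (\<lambda>x. - s x)"
proof -
  interpret s: Vector_Spaces.linear scl scl s using s by (simp add: antisymplectic_involution_def)
  have "Vector_Spaces.linear scl scl (\<lambda>x. - s x)"
    by unfold_locales (auto simp: s.add s.scale)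
  then show ?thesis
    using s by (simp add: antisymplectic_involution_def has_similitude_def s.neg B_simps)
qed

lemma Sp_conjugate_if_same_negated_space:
  assumes two: "(2::'a) \<noteq> 0" and s: "antisymplectic_involution s" and t: "antisymplectic_involution t"
    and negated: "\<And>x. s x = - x \<longleftrightarrow> t x = - x"
  shows "Sp_conjugate s t"
proof -
  have "Sp_conjugate (\<lambda>x. - s x) (\<lambda>x. - t x)"
    using negated by (intro Sp_conjugate_if_same_fixed_space[OF two] antisymplectic_involution_minus s t)
      (metis minus_minus)
  then obtain k where k: "k \<in> carrier (Sp scl B)" "\<forall>x. k (- s x) = - t (k x)"
    by (auto simp: Sp_conjugate_def)
  interpret k: Vector_Spaces.linear scl scl k by (rule SpD(1)[OF k(1)])
  show ?thesis using k by (auto simp: Sp_conjugate_def k.neg)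
qed

lemma eigenspaces:
  assumes two: "(2::'a) \<noteq> 0" and s: "antisymplectic_involution s"
  shows "subspace {x. s x = x}" "subspace {x. s x = - x}" "isotropic {x. s x = x}"
    "isotropic {x. s x = - x}" "sum_set {x. s x = x} {x. s x = - x} = UNIV"
proof -
  interpret s: Vector_Spaces.linear scl scl s using s by (simp add: antisymplectic_involution_def)
  have ss: "s (s x) = x" and Bs: "B (s x) (s y) = - B x y" for x y
    using s by (simp_all add: antisymplectic_involution_def has_similitude_def)
  show "subspace {x. s x = x}" "subspace {x. s x = - x}"
    by (auto simp: subspace_def s.add s.scale s.zero)
  have "B x y = 0" if "B (s x) (s y) = B x y" for x y
    using that Bs[of x y] by (intro eq_minus_self_imp_zero[OF two]) simp
  then show "isotropic {x. s x = x}" "isotropic {x. s x = - x}"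
    by (simp_all add: isotropic_def B_simps)
  have "x \<in> sum_set {x. s x = x} {x. s x = - x}" for x
  proof -
    have "scl (1/2) (x + s x) + scl (1/2) (x - s x) = scl (1/2) (scl 2 x)"
      using scale_left_distrib[of 1 1 x] by (simp add: algebra_simps flip: scale_right_distrib)
    also have "\<dots> = x" using two by simp
    finally show ?thesis
      using sum_set_memI[of "scl (1/2) (x + s x)" "{x. s x = x}" "scl (1/2) (x - s x)" "{x. s x = - x}"]
      by (simp add: s.scale s.add s.diff ss add.commute flip: scale_minus_right)
  qed
  then show "sum_set {x. s x = x} {x. s x = - x} = UNIV" by blast
qed

text \<open>An antisymplectic involution amounts to a pair of complementary Lagrangians, its eigenspaces. With a
  common complement \<open>N\<close> of the two fixed spaces, one passes from \<open>s\<close> to \<open>t\<close> by exchanging one eigenspace at a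
  time: first the negated one for \<open>N\<close>, then the fixed one, then \<open>N\<close> again.\<close>

theorem antisymplectic_involutions_conjugate:
  assumes two: "(2::'a) \<noteq> 0" and s: "antisymplectic_involution s" and t: "antisymplectic_involution t"
  shows "Sp_conjugate s t"
proof -
  note es = eigenspaces[OF two s] and et = eigenspaces[OF two t]
  obtain N where N: "subspace N" "isotropic N" "sum_set {x. s x = x} N = UNIV"
      "sum_set {x. t x = x} N = UNIV"
    using common_lagrangian_complement lagrangian_if_complement[OF es(1,3,4,5)]
      lagrangian_if_complement[OF et(1,3,4,5)] by blast
  obtain u where u: "antisymplectic_involution u" "\<And>x. u x = x \<longleftrightarrow> s x = x" "\<And>x. u x = - x \<longleftrightarrow> x \<in> N"
    using involution_of_pair[OF two es(1) N(1) es(3) N(2,3)] by auto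
  obtain v where v: "antisymplectic_involution v" "\<And>x. v x = x \<longleftrightarrow> t x = x" "\<And>x. v x = - x \<longleftrightarrow> x \<in> N"
    using involution_of_pair[OF two et(1) N(1) et(3) N(2,4)] by auto
  have "Sp_conjugate s u" by (rule Sp_conjugate_if_same_fixed_space[OF two s u(1)]) (simp add: u(2))
  moreover have "Sp_conjugate u v"
    by (rule Sp_conjugate_if_same_negated_space[OF two u(1) v(1)]) (simp add: u(3) v(3))
  moreover have "Sp_conjugate v t"
    by (rule Sp_conjugate_if_same_fixed_space[OF two v(1) t]) (simp add: v(2))
  ultimately show ?thesis using Sp_conjugate_trans by blast
qed

text \<open>If \<open>s\<close> inverts \<open>g\<close>, then \<open>g = s t\<close> with the involution \<open>t = s g\<close>. Conjugating both factors to \<open>s0\<close> writes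
  \<open>g\<close> as \<open>(m s0 m\<^sup>-\<^sup>1) (n s0 n\<^sup>-\<^sup>1)\<close>. The statement arranges this product so that \<open>s0\<close> occurs only through the
  automorphism of \<open>Sp(W)\<close> that it induces.\<close>

theorem factorization_via_involution:
  assumes two: "(2::'a) \<noteq> 0" and s0: "antisymplectic_involution s0" and g: "g \<in> carrier (Sp scl B)"
  shows "\<exists>m\<in>carrier (Sp scl B). \<exists>n\<in>carrier (Sp scl B).
    g = m \<circ> (s0 \<circ> (inv\<^bsub>Sp scl B\<^esub> m \<circ> n) \<circ> s0) \<circ> inv\<^bsub>Sp scl B\<^esub> n"
proof -
  interpret G: group "Sp scl B" by (rule group_Sp)
  obtain s where s: "antisymplectic_involution s" "\<And>x. s (g (s (g x))) = x"
    using inverted_by_antisymplectic_involution[OF two g] by blast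
  define t where "t = s \<circ> g"
  have "antisymplectic_involution t"
    using s SpD[OF g] Vector_Spaces.linear_compose[of scl scl g scl s]
    by (simp add: antisymplectic_involution_def has_similitude_def t_def)
  then obtain m n where m: "m \<in> carrier (Sp scl B)" "\<And>x. m (s0 x) = s (m x)"
    and n: "n \<in> carrier (Sp scl B)" "\<And>x. n (s0 x) = t (n x)"
    using antisymplectic_involutions_conjugate[OF two s0] s(1) unfolding Sp_conjugate_def by metis
  have inv: "k ((inv\<^bsub>Sp scl B\<^esub> k) x) = x" if "k \<in> carrier (Sp scl B)" for k x
    using G.r_inv[OF that] by (simp add: Sp_def GSp_def fun_eq_iff)
  have "s (t x) = g x" for x
    using s(1) by (simp add: t_def antisymplectic_involution_def)
  then have "g = m \<circ> (s0 \<circ> (inv\<^bsub>Sp scl B\<^esub> m \<circ> n) \<circ> s0) \<circ> inv\<^bsub>Sp scl B\<^esub> n"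
    using m n inv[OF m(1)] inv[OF n(1)] by (simp add: fun_eq_iff)
  then show ?thesis using m n by blast
qed

lemma ex_antisymplectic_involution:
  assumes "(2::'a) \<noteq> 0" shows "\<exists>s. antisymplectic_involution s"
  using inverted_by_antisymplectic_involution[OF assms, of id] isometry_in_Sp[OF linear_id] by auto

end

section \<open>Lifting to central extensions by a group of order two\<close>

text \<open>Here \<open>\<sigma>\<close> plays the role of conjugation by an antisymplectic involution \<open>s0\<close>, and \<open>factor\<close> is the
  factorization above. In a group containing \<open>E\<close> and a lift of \<open>s0\<close> that induces \<open>\<psi>\<close>, every \<open>x\<close> is, up to an
  element of the kernel, a product of two conjugates \<open>a\<close> and \<open>b\<close> of that lift. As conjugates, \<open>a\<close> and \<open>b\<close>
  have the same central square, and \<open>a b\<close> is conjugate to \<open>b a\<close>, which is the inverse of \<open>a b\<close> up to the product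
  of the two squares. This product is trivial, since the two squares agree and have order at most two.

  The computation stays inside \<open>E\<close>. What has to be checked is that \<open>\<psi>\<close> is an involution. It is one
  up to a homomorphism \<open>\<epsilon>\<close> with values in the kernel; \<open>\<epsilon>\<close> is invariant under \<open>\<psi>\<close>, and the factorization of
  \<open>x\<close> then makes \<open>\<epsilon> x\<close> telescope to the identity.\<close>

lemma lift_conjugate_to_inverse:
  fixes E (structure) and G (structure)
  assumes "group E" and "group G" and \<pi>: "\<pi> \<in> hom E G" and surj: "\<pi> ` carrier E = carrier G"
    and central: "\<And>z x. z \<in> kernel E G \<pi> \<Longrightarrow> x \<in> carrier E \<Longrightarrow> z \<otimes>\<^bsub>E\<^esub> x = x \<otimes>\<^bsub>E\<^esub> z"
    and order2: "\<And>z. z \<in> kernel E G \<pi> \<Longrightarrow> z \<otimes>\<^bsub>E\<^esub> z = \<one>\<^bsub>E\<^esub>"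
    and \<psi>: "\<psi> \<in> hom E E" and \<psi>_kernel: "\<And>z. z \<in> kernel E G \<pi> \<Longrightarrow> \<psi> z = z"
    and lift: "\<And>x. x \<in> carrier E \<Longrightarrow> \<pi> (\<psi> x) = \<sigma> (\<pi> x)"
    and involutive: "\<And>g. g \<in> carrier G \<Longrightarrow> \<sigma> (\<sigma> g) = g"
    and factor: "\<And>g. g \<in> carrier G \<Longrightarrow> \<exists>m\<in>carrier G. \<exists>n\<in>carrier G.
      g = m \<otimes>\<^bsub>G\<^esub> \<sigma> (inv\<^bsub>G\<^esub> m \<otimes>\<^bsub>G\<^esub> n) \<otimes>\<^bsub>G\<^esub> inv\<^bsub>G\<^esub> n"
    and x: "x \<in> carrier E"
  shows "\<exists>h\<in>carrier E. \<psi> x = h \<otimes>\<^bsub>E\<^esub> inv\<^bsub>E\<^esub> x \<otimes>\<^bsub>E\<^esub> inv\<^bsub>E\<^esub> h"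
proof -
  interpret E: group E by fact
  interpret G: group G by fact
  interpret p: group_hom E G \<pi> using \<pi> by unfold_locales
  interpret q: group_hom E E \<psi> using \<psi> by unfold_locales
  let ?K = "kernel E G \<pi>"
  have KE: "z \<in> carrier E" if "z \<in> ?K" for z using that by (simp add: kernel_def)
  have same_image: "\<exists>z\<in>?K. a = z \<otimes>\<^bsub>E\<^esub> b" if "a \<in> carrier E" "b \<in> carrier E" "\<pi> a = \<pi> b" for a b
    using that by (intro bexI[of _ "a \<otimes>\<^bsub>E\<^esub> inv\<^bsub>E\<^esub> b"]) (auto simp: kernel_def E.m_assoc)

  \<comment> \<open>The failure of \<open>\<psi>\<close> to be an involution.\<close>
  define \<epsilon> where "\<epsilon> a = \<psi> (\<psi> a) \<otimes>\<^bsub>E\<^esub> inv\<^bsub>E\<^esub> a" for a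
  have \<epsilon>K: "\<epsilon> a \<in> ?K" if "a \<in> carrier E" for a
    using that by (auto simp: kernel_def \<epsilon>_def lift involutive p.hom_closed)
  have \<psi>\<psi>: "\<psi> (\<psi> a) = \<epsilon> a \<otimes>\<^bsub>E\<^esub> a" if "a \<in> carrier E" for a
    using that by (simp add: \<epsilon>_def E.m_assoc)
  have \<epsilon>_unique: "\<epsilon> a = z" if "a \<in> carrier E" "z \<in> carrier E" "\<psi> (\<psi> a) = z \<otimes>\<^bsub>E\<^esub> a" for a z
    using that by (simp add: \<epsilon>_def E.m_assoc)
  have \<epsilon>_mult: "\<epsilon> (a \<otimes>\<^bsub>E\<^esub> b) = \<epsilon> a \<otimes>\<^bsub>E\<^esub> \<epsilon> b" if ab: "a \<in> carrier E" "b \<in> carrier E" for a b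
  proof (rule \<epsilon>_unique)
    have "\<psi> (\<psi> (a \<otimes>\<^bsub>E\<^esub> b)) = \<epsilon> a \<otimes>\<^bsub>E\<^esub> (a \<otimes>\<^bsub>E\<^esub> \<epsilon> b) \<otimes>\<^bsub>E\<^esub> b"
      using ab \<epsilon>K KE by (simp add: \<psi>\<psi> E.m_assoc)
    also have "a \<otimes>\<^bsub>E\<^esub> \<epsilon> b = \<epsilon> b \<otimes>\<^bsub>E\<^esub> a" using central[OF \<epsilon>K] ab by simp
    finally show "\<psi> (\<psi> (a \<otimes>\<^bsub>E\<^esub> b)) = \<epsilon> a \<otimes>\<^bsub>E\<^esub> \<epsilon> b \<otimes>\<^bsub>E\<^esub> (a \<otimes>\<^bsub>E\<^esub> b)"
      using ab \<epsilon>K KE by (simp add: E.m_assoc)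
  qed (use ab \<epsilon>K KE in auto)
  have \<epsilon>_\<psi>: "\<epsilon> (\<psi> a) = \<epsilon> a" if a: "a \<in> carrier E" for a
  proof (rule \<epsilon>_unique)
    have "\<psi> (\<psi> (\<psi> a)) = \<psi> (\<epsilon> a) \<otimes>\<^bsub>E\<^esub> \<psi> a" using a \<epsilon>K KE by (simp add: \<psi>\<psi>)
    then show "\<psi> (\<psi> (\<psi> a)) = \<epsilon> a \<otimes>\<^bsub>E\<^esub> \<psi> a" using a \<epsilon>K by (simp add: \<psi>_kernel)
  qed (use a \<epsilon>K KE in auto)
  have \<epsilon>_kernel: "\<epsilon> z = \<one>\<^bsub>E\<^esub>" if "z \<in> ?K" for z
    using that KE by (simp add: \<epsilon>_def \<psi>_kernel)

  have decomposition: "\<exists>z\<in>?K. \<exists>m\<in>carrier E. \<exists>n\<in>carrier E.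
      a = z \<otimes>\<^bsub>E\<^esub> (m \<otimes>\<^bsub>E\<^esub> \<psi> (inv\<^bsub>E\<^esub> m \<otimes>\<^bsub>E\<^esub> n) \<otimes>\<^bsub>E\<^esub> inv\<^bsub>E\<^esub> n)" if a: "a \<in> carrier E" for a
  proof -
    obtain m' n' where "m' \<in> carrier G" "n' \<in> carrier G"
      and mn: "\<pi> a = m' \<otimes>\<^bsub>G\<^esub> \<sigma> (inv\<^bsub>G\<^esub> m' \<otimes>\<^bsub>G\<^esub> n') \<otimes>\<^bsub>G\<^esub> inv\<^bsub>G\<^esub> n'"
      using factor[of "\<pi> a"] a by auto
    then obtain m n where m: "m \<in> carrier E" "\<pi> m = m'" and n: "n \<in> carrier E" "\<pi> n = n'"
      using surj by (metis imageE)
    have "\<pi> a = \<pi> (m \<otimes>\<^bsub>E\<^esub> \<psi> (inv\<^bsub>E\<^esub> m \<otimes>\<^bsub>E\<^esub> n) \<otimes>\<^bsub>E\<^esub> inv\<^bsub>E\<^esub> n)"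
      using m n by (simp add: mn lift del: q.hom_mult)
    moreover have "m \<otimes>\<^bsub>E\<^esub> \<psi> (inv\<^bsub>E\<^esub> m \<otimes>\<^bsub>E\<^esub> n) \<otimes>\<^bsub>E\<^esub> inv\<^bsub>E\<^esub> n \<in> carrier E"
      using m n by (simp del: q.hom_mult)
    ultimately obtain z where "z \<in> ?K"
      "a = z \<otimes>\<^bsub>E\<^esub> (m \<otimes>\<^bsub>E\<^esub> \<psi> (inv\<^bsub>E\<^esub> m \<otimes>\<^bsub>E\<^esub> n) \<otimes>\<^bsub>E\<^esub> inv\<^bsub>E\<^esub> n)"
      using same_image[OF a] by metis
    then show ?thesis using m n by blast
  qed
  have \<epsilon>_trivial: "\<epsilon> a = \<one>\<^bsub>E\<^esub>" if a: "a \<in> carrier E" for a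
  proof -
    obtain z m n where z: "z \<in> ?K" and m: "m \<in> carrier E" and n: "n \<in> carrier E"
      and a': "a = z \<otimes>\<^bsub>E\<^esub> (m \<otimes>\<^bsub>E\<^esub> \<psi> (inv\<^bsub>E\<^esub> m \<otimes>\<^bsub>E\<^esub> n) \<otimes>\<^bsub>E\<^esub> inv\<^bsub>E\<^esub> n)"
      using decomposition[OF a] by blast
    have "\<epsilon> a = \<epsilon> m \<otimes>\<^bsub>E\<^esub> \<epsilon> (inv\<^bsub>E\<^esub> m \<otimes>\<^bsub>E\<^esub> n) \<otimes>\<^bsub>E\<^esub> \<epsilon> (inv\<^bsub>E\<^esub> n)"
      unfolding a' using z m n KE \<epsilon>K by (simp add: \<epsilon>_mult \<epsilon>_\<psi> \<epsilon>_kernel del: q.hom_mult)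
    also have "\<dots> = \<epsilon> (m \<otimes>\<^bsub>E\<^esub> (inv\<^bsub>E\<^esub> m \<otimes>\<^bsub>E\<^esub> n) \<otimes>\<^bsub>E\<^esub> inv\<^bsub>E\<^esub> n)"
      using m n by (simp only: \<epsilon>_mult E.m_closed E.inv_closed)
    also have "m \<otimes>\<^bsub>E\<^esub> (inv\<^bsub>E\<^esub> m \<otimes>\<^bsub>E\<^esub> n) \<otimes>\<^bsub>E\<^esub> inv\<^bsub>E\<^esub> n = \<one>\<^bsub>E\<^esub>"
      using m n by (simp add: E.m_assoc[symmetric])
    finally show ?thesis using \<epsilon>_kernel[of "\<one>\<^bsub>E\<^esub>"] by (simp add: kernel_def)
  qed

  obtain z m n where z: "z \<in> ?K" and m: "m \<in> carrier E" and n: "n \<in> carrier E"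
    and x': "x = z \<otimes>\<^bsub>E\<^esub> (m \<otimes>\<^bsub>E\<^esub> \<psi> (inv\<^bsub>E\<^esub> m \<otimes>\<^bsub>E\<^esub> n) \<otimes>\<^bsub>E\<^esub> inv\<^bsub>E\<^esub> n)"
    using decomposition[OF x] by blast
  have zE: "z \<in> carrier E" using z KE by blast
  have zinv: "inv\<^bsub>E\<^esub> z = z" using order2[OF z] zE by (simp add: E.inv_equality)
  \<comment> \<open>Conjugating \<open>x\<close> by \<open>m\<close> gives a twisted commutator \<open>y\<close>, which \<open>\<psi>\<close> visibly inverts.\<close>
  define k where "k = inv\<^bsub>E\<^esub> m \<otimes>\<^bsub>E\<^esub> n"
  define y where "y = z \<otimes>\<^bsub>E\<^esub> (\<psi> k \<otimes>\<^bsub>E\<^esub> inv\<^bsub>E\<^esub> k)"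
  have k: "k \<in> carrier E" and y: "y \<in> carrier E" using m n zE by (auto simp: k_def y_def)
  have "m \<otimes>\<^bsub>E\<^esub> y = z \<otimes>\<^bsub>E\<^esub> m \<otimes>\<^bsub>E\<^esub> (\<psi> k \<otimes>\<^bsub>E\<^esub> inv\<^bsub>E\<^esub> k)"
    using central[OF z m] m zE k by (simp add: y_def E.m_assoc[symmetric])
  also have "\<dots> = x \<otimes>\<^bsub>E\<^esub> m"
    using m n zE k by (simp add: x' E.m_assoc E.inv_mult_group k_def del: q.hom_mult)
  finally have xy: "x = m \<otimes>\<^bsub>E\<^esub> y \<otimes>\<^bsub>E\<^esub> inv\<^bsub>E\<^esub> m" using x m y by (simp add: E.m_assoc)
  have "\<psi> y = z \<otimes>\<^bsub>E\<^esub> (k \<otimes>\<^bsub>E\<^esub> inv\<^bsub>E\<^esub> \<psi> k)"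
    using zE k by (simp add: y_def \<psi>\<psi> \<epsilon>_trivial \<psi>_kernel z)
  also have "\<dots> = inv\<^bsub>E\<^esub> y"
    using central[OF z] zE k by (simp add: y_def E.inv_mult_group zinv)
  finally have "\<psi> x = \<psi> m \<otimes>\<^bsub>E\<^esub> inv\<^bsub>E\<^esub> y \<otimes>\<^bsub>E\<^esub> inv\<^bsub>E\<^esub> \<psi> m"
    using m y by (simp add: xy)
  also have "inv\<^bsub>E\<^esub> y = inv\<^bsub>E\<^esub> m \<otimes>\<^bsub>E\<^esub> inv\<^bsub>E\<^esub> x \<otimes>\<^bsub>E\<^esub> m"
    using m y by (simp add: xy E.inv_mult_group E.m_assoc[symmetric]) (simp add: E.m_assoc)
  finally have \<psi>x: "\<psi> x = \<psi> m \<otimes>\<^bsub>E\<^esub> (inv\<^bsub>E\<^esub> m \<otimes>\<^bsub>E\<^esub> inv\<^bsub>E\<^esub> x \<otimes>\<^bsub>E\<^esub> m) \<otimes>\<^bsub>E\<^esub> inv\<^bsub>E\<^esub> \<psi> m" .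
  have "a \<otimes>\<^bsub>E\<^esub> (inv\<^bsub>E\<^esub> m \<otimes>\<^bsub>E\<^esub> b \<otimes>\<^bsub>E\<^esub> m) \<otimes>\<^bsub>E\<^esub> inv\<^bsub>E\<^esub> a =
      (a \<otimes>\<^bsub>E\<^esub> inv\<^bsub>E\<^esub> m) \<otimes>\<^bsub>E\<^esub> b \<otimes>\<^bsub>E\<^esub> inv\<^bsub>E\<^esub> (a \<otimes>\<^bsub>E\<^esub> inv\<^bsub>E\<^esub> m)"
    if "a \<in> carrier E" "b \<in> carrier E" for a b
    using that m by (simp add: E.inv_mult_group E.m_assoc)
  from this[of "\<psi> m" "inv\<^bsub>E\<^esub> x"] show ?thesis unfolding \<psi>x using m x
    by (intro bexI[of _ "\<psi> m \<otimes>\<^bsub>E\<^esub> inv\<^bsub>E\<^esub> m"]) (auto simp del: q.hom_inv)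
qed

theorem proposition2:
  fixes absv :: "'a::field \<Rightarrow> real" and p :: nat
    and scl :: "'a \<Rightarrow> 'w::ab_group_add \<Rightarrow> 'w" and B :: "'w \<Rightarrow> 'w \<Rightarrow> 'a" and n :: nat
    and Mp :: "('m, 's) monoid_scheme" and TMp :: "'m topology"
    and \<iota> :: "int \<Rightarrow> 'm" and \<pi> :: "'m \<Rightarrow> 'w \<Rightarrow> 'w"
    and \<delta> :: "'w \<Rightarrow> 'w" and \<phi> :: "'m \<Rightarrow> 'm"
  assumes "nonarch_local_field absv"
    and "CHAR('a) \<noteq> 2"
    and "residue_char absv = p"
    and "symplectic_space scl B n"
    and "metaplectic_extension absv scl B Mp TMp \<iota> \<pi>"
    and "\<delta> \<in> carrier (GSp scl B)"
    and "has_similitude B \<delta> (-1)"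
    and "\<phi> \<in> iso Mp Mp"
    and "\<forall>x \<in> carrier Mp.
      \<pi> (\<phi> x) = \<delta> \<otimes>\<^bsub>GSp scl B\<^esub> \<pi> x \<otimes>\<^bsub>GSp scl B\<^esub> inv\<^bsub>GSp scl B\<^esub> \<delta>"
  shows "\<forall>x \<in> carrier Mp. \<exists>h \<in> carrier Mp. \<phi> x = h \<otimes>\<^bsub>Mp\<^esub> inv\<^bsub>Mp\<^esub> x \<otimes>\<^bsub>Mp\<^esub> inv\<^bsub>Mp\<^esub> h"
proof (intro ballI)
  fix x assume x: "x \<in> carrier Mp"
  interpret symplectic_space scl B n by fact
  interpret TE: topological_central_extension mu2 "discrete_topology (carrier mu2)" Mp TMp
      "Sp scl B" "Sp_topology absv scl B" \<iota> \<pi>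
    using assms(5) by (simp add: metaplectic_extension_def)
  interpret GS: group "GSp scl B" by (rule group_GSp)
  interpret i: group_hom mu2 Mp \<iota> using TE.incl_hom by unfold_locales
  interpret p: group_hom Mp "Sp scl B" \<pi> using TE.proj_hom by unfold_locales
  interpret f: group_hom Mp Mp \<phi> using assms(8) by unfold_locales (auto simp: iso_def)
  have two: "(2::'a) \<noteq> 0"
  proof
    assume "(2::'a) = 0"
    then have "CHAR('a) dvd 2" using of_nat_eq_0_iff_char_dvd[of 2, where 'a = 'a] by simp
    then have "CHAR('a) = 1 \<or> CHAR('a) = 2" using two_is_prime_nat prime_nat_iff by blast
    then show False using assms(2) CHAR_not_1'[where 'a = 'a] by simp
  qed
  have mult: "g \<otimes>\<^bsub>Sp scl B\<^esub> h = g \<circ> h" "g \<otimes>\<^bsub>GSp scl B\<^esub> h = g \<circ> h"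
      "\<one>\<^bsub>Sp scl B\<^esub> = id" "\<one>\<^bsub>GSp scl B\<^esub> = id" for g h
    by (simp_all add: Sp_def GSp_def)
  have surj: "\<pi> ` carrier Mp = carrier (Sp scl B)"
    using quotient_imp_surjective_map[OF TE.proj_quotient] by (simp add: TE.E.topspace_eq TE.G.topspace_eq)
  have one: "\<iota> 1 = \<one>\<^bsub>Mp\<^esub>" using i.hom_one by (simp add: mu2_def)
  have kernel: "kernel Mp (Sp scl B) \<pi> = {\<one>\<^bsub>Mp\<^esub>, \<iota> (-1)}"
    using TE.exact one by (simp add: mu2_def)
  have order2: "z \<otimes>\<^bsub>Mp\<^esub> z = \<one>\<^bsub>Mp\<^esub>" if "z \<in> kernel Mp (Sp scl B) \<pi>" for z
    using that i.hom_mult[of "-1" "-1"] one by (auto simp: kernel mu2_def)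
  have central: "z \<otimes>\<^bsub>Mp\<^esub> y = y \<otimes>\<^bsub>Mp\<^esub> z"
    if "z \<in> kernel Mp (Sp scl B) \<pi>" "y \<in> carrier Mp" for z y
    using that TE.central by (auto simp flip: TE.exact)
  define \<delta>' where "\<delta>' = inv\<^bsub>GSp scl B\<^esub> \<delta>"
  have \<delta>': "\<delta> (\<delta>' w) = w" "\<delta>' (\<delta> w) = w" for w
    using GS.r_inv[OF assms(6)] GS.l_inv[OF assms(6)] by (simp_all add: mult \<delta>'_def fun_eq_iff)
  have \<pi>\<phi>: "\<pi> (\<phi> y) = \<delta> \<circ> \<pi> y \<circ> \<delta>'" if "y \<in> carrier Mp" for y
    using assms(9) that by (simp add: mult \<delta>'_def)
  have \<phi>_kernel: "\<phi> z = z" if z: "z \<in> kernel Mp (Sp scl B) \<pi>" for z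
  proof -
    have zE: "z \<in> carrier Mp" and "\<pi> z = id" using z by (simp_all add: kernel_def mult)
    then have "\<phi> z \<in> kernel Mp (Sp scl B) \<pi>"
      using \<pi>\<phi>[OF zE] by (simp add: kernel_def mult fun_eq_iff \<delta>')
    moreover have "\<phi> z = \<one>\<^bsub>Mp\<^esub> \<longrightarrow> z = \<one>\<^bsub>Mp\<^esub>"
    proof
      have "inj_on \<phi> (carrier Mp)" using assms(8) by (simp add: iso_def bij_betw_def)
      moreover assume "\<phi> z = \<one>\<^bsub>Mp\<^esub>"
      then have "\<phi> z = \<phi> \<one>\<^bsub>Mp\<^esub>" by simp
      ultimately show "z = \<one>\<^bsub>Mp\<^esub>" using zE by (rule inj_onD) simp
    qed
    ultimately show ?thesis using z f.hom_one unfolding kernel by (cases "z = \<one>\<^bsub>Mp\<^esub>") blast+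
  qed

  \<comment> \<open>Composing \<open>\<phi>\<close> with an inner automorphism replaces \<open>\<delta>\<close> by an antisymplectic involution \<open>s\<close>.\<close>
  obtain s where s: "antisymplectic_involution s" using ex_antisymplectic_involution[OF two] by blast
  have ss: "s (s w) = w" for w using s by (simp add: antisymplectic_involution_def)
  have "Vector_Spaces.linear scl scl \<delta>'"
    using GS.inv_closed[OF assms(6)] by (simp add: GSp_def \<delta>'_def)
  moreover have "B (s (\<delta>' v)) (s (\<delta>' w)) = B v w" for v w
    using s assms(7) \<delta>'(1) unfolding antisymplectic_involution_def has_similitude_def by metis
  ultimately have h: "s \<circ> \<delta>' \<in> carrier (Sp scl B)"
    using s Vector_Spaces.linear_compose[of scl scl \<delta>' scl s]
    by (intro isometry_in_Sp) (auto simp: antisymplectic_involution_def)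
  then obtain k where k: "k \<in> carrier Mp" "\<pi> k = s \<circ> \<delta>'" using surj by (metis imageE)
  have inv_h: "(inv\<^bsub>Sp scl B\<^esub> (s \<circ> \<delta>')) w = \<delta> (s w)" for w
  proof -
    have "(s \<circ> \<delta>') ((inv\<^bsub>Sp scl B\<^esub> (s \<circ> \<delta>')) w) = w"
      using TE.G.r_inv[OF h] by (simp add: mult fun_eq_iff)
    then have "\<delta> (s (s (\<delta>' ((inv\<^bsub>Sp scl B\<^esub> (s \<circ> \<delta>')) w)))) = \<delta> (s w)" by simp
    then show ?thesis by (simp add: ss \<delta>')
  qed
  define \<psi> where "\<psi> y = k \<otimes>\<^bsub>Mp\<^esub> \<phi> y \<otimes>\<^bsub>Mp\<^esub> inv\<^bsub>Mp\<^esub> k" for y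
  have "\<exists>h\<in>carrier Mp. \<psi> x = h \<otimes>\<^bsub>Mp\<^esub> inv\<^bsub>Mp\<^esub> x \<otimes>\<^bsub>Mp\<^esub> inv\<^bsub>Mp\<^esub> h"
  proof (rule lift_conjugate_to_inverse[OF TE.E.group_axioms TE.G.group_axioms TE.proj_hom surj central order2,
        where \<sigma> = "\<lambda>g. s \<circ> g \<circ> s"])
    show "\<psi> \<in> hom Mp Mp"
      using k by (auto simp: hom_def \<psi>_def TE.E.m_assoc) (simp flip: TE.E.m_assoc)
    show "\<psi> z = z" if "z \<in> kernel Mp (Sp scl B) \<pi>" for z
      using that k(1)
      by (simp add: \<psi>_def \<phi>_kernel kernel_def TE.E.m_assoc flip: central[OF that k(1)])
    show "\<pi> (\<psi> y) = s \<circ> \<pi> y \<circ> s" if "y \<in> carrier Mp" for y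
    proof -
      have "\<pi> (\<psi> y) = \<pi> k \<circ> (\<delta> \<circ> \<pi> y \<circ> \<delta>') \<circ> inv\<^bsub>Sp scl B\<^esub> (\<pi> k)"
        using that k(1) by (simp add: \<psi>_def mult \<pi>\<phi>)
      then show ?thesis unfolding k(2) by (simp add: fun_eq_iff inv_h \<delta>')
    qed
    show "s \<circ> (s \<circ> g \<circ> s) \<circ> s = g" for g by (simp add: fun_eq_iff ss)
    show "\<exists>m\<in>carrier (Sp scl B). \<exists>n\<in>carrier (Sp scl B). g = m \<otimes>\<^bsub>Sp scl B\<^esub>
        (s \<circ> (inv\<^bsub>Sp scl B\<^esub> m \<otimes>\<^bsub>Sp scl B\<^esub> n) \<circ> s) \<otimes>\<^bsub>Sp scl B\<^esub> inv\<^bsub>Sp scl B\<^esub> n"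
      if "g \<in> carrier (Sp scl B)" for g
      using factorization_via_involution[OF two s that] by (simp add: mult)
  qed (use x in auto)
  then obtain h where h: "h \<in> carrier Mp" "\<psi> x = h \<otimes>\<^bsub>Mp\<^esub> inv\<^bsub>Mp\<^esub> x \<otimes>\<^bsub>Mp\<^esub> inv\<^bsub>Mp\<^esub> h" by blast
  have "\<phi> x = inv\<^bsub>Mp\<^esub> k \<otimes>\<^bsub>Mp\<^esub> \<psi> x \<otimes>\<^bsub>Mp\<^esub> k"
    using k x by (simp add: \<psi>_def TE.E.m_assoc) (simp flip: TE.E.m_assoc)
  then have "\<phi> x = (inv\<^bsub>Mp\<^esub> k \<otimes>\<^bsub>Mp\<^esub> h) \<otimes>\<^bsub>Mp\<^esub> inv\<^bsub>Mp\<^esub> x \<otimes>\<^bsub>Mp\<^esub> inv\<^bsub>Mp\<^esub> (inv\<^bsub>Mp\<^esub> k \<otimes>\<^bsub>Mp\<^esub> h)"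
    using k h x by (simp add: TE.E.inv_mult_group TE.E.m_assoc)
  then show "\<exists>h\<in>carrier Mp. \<phi> x = h \<otimes>\<^bsub>Mp\<^esub> inv\<^bsub>Mp\<^esub> x \<otimes>\<^bsub>Mp\<^esub> inv\<^bsub>Mp\<^esub> h"
    using k h by blast
qed

end
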